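(* Let $\epsilon>0$, $0<\delta<1$, and $\rho\in\mathbb R_+^n$. Consider $n$ systems $x_{i,t+1}=A_ix_{i,t}+B_iw_{i,t}$ with measurements $y_{i,t}=C_ix_{i,t}+D_iw_{i,t}$, $t\ge0$, $1\le i\le n$, matrices $L_i$, selection matrices $S_i$, and steady-state Kalman filters $\mathcal K_i$, as described in the context. Let $\gamma_i$ be the $\mathcal H_\infty$ norm of the transfer function $L_i\mathcal K_iC_iS_i$ and let $\gamma=\max_{1\le i\le n}\{\gamma_i\rho_i\}$. Then the mechanism releasing the signal $$\left(\sum_{i=1}^nL_i\mathcal K_iy_i\right)+\gamma\,\kappa(\delta,\epsilon)\,\nu,$$ where $\nu$ is a standard white Gaussian noise independent of $\{w_i\}_{1\le i\le n}$ and $\{x_{i,0}\}_{1\le i\le n}$, is $(\epsilon,\delta)$-differentially private for the following adjacency relation on global state trajectories $x=(x_1,\dots,x_n)$: $\mathrm{Adj}^\rho_{\mathcal S}(x,x')$ iff for some $i$, $\|S_ix_i-S_ix_i'\|_2\le\rho_i$, $(I-S_i)x_i=(I-S_i)x_i'$, and $x_j=x_j'$ for all $j\ne i$.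
   Context: Setting. For each $i$, $w_i$ is a standard zero-mean Gaussian white noise (identity covariance), and $x_{i,0}$ is Gaussian with publicly known mean $\bar x_{i,0}$, independent of $w_i$; the systems are independent. The matrices $A_i,B_i,C_i,D_i,L_i$ are public, $D_i$ has full row rank, $(A_i,C_i)$ is detectable and $(A_i,B_i)$ is stabilizable. $S_i$ is a diagonal matrix with diagonal entries in $\{0,1\}$: $[S_i]_{jj}=1$ iff $j$ belongs to a given subset $\mathcal S_i$ of the coordinates of the state $x_i$. The signal norm is $\|x\|_2=\left(\sum_t\|x_t\|_2^2\right)^{1/2}$. Kalman filter. $\mathcal K_i$ is the (stable, causal, time-invariant) steady-state Kalman filter mapping the measurement signal $y_i$ to the estimate $\hat x_{i,t}$ of $x_{i,t}$ from measurements up to time $t$: dropping the index $i$, with $\Sigma$ the stabilizing solution of the filtering Riccati equation $\Sigma=A\Sigma A^T+BB^T-(A\Sigma C^T+BD^T)(C\Sigma C^T+DD^T)^{-1}(A\Sigma C^T+BD^T)^T$, $$\hat x^-_{t+1}=A\hat x^-_t+(A\Sigma C^T+BD^T)(C\Sigma C^T+DD^T)^{-1}(y_t-C\hat x^-_t),\quad \hat x_t=\hat x^-_t+\Sigma C^T(C\Sigma C^T+DD^T)^{-1}(y_t-C\hat x^-_t),$$ with a fixed, publicly known initial condition. The transfer function $L_i\mathcal K_iC_iS_i$ is that of the linear map $v\mapsto L_i\mathcal K_i(C_iS_iv)$ (zero initial condition). The $\mathcal H_\infty$ norm of a stable transfer function is $\|\mathcal G\|_\infty=\operatorname{ess\,sup}_{\omega\in[-\pi,\pi)}\sigma_{\max}(\mathcal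 G(e^{i\omega}))$. Privacy. $\mathcal Q(x)=\frac1{\sqrt{2\pi}}\int_x^\infty e^{-u^2/2}du$ and $\kappa(\delta,\epsilon)=\frac1{2\epsilon}\left(K+\sqrt{K^2+2\epsilon}\right)$ with $K=\mathcal Q^{-1}(\delta)$. The dataset is the global state trajectory $x$; the measurement noise $D_iw_i$ is taken to have the same realization for $x$ and $x'$, i.e. for each fixed realization $v_i$ of the signals $D_iw_i$, the mechanism is $M(x)=\sum_iL_i\mathcal K_i(C_ix_i+v_i)+\gamma\,\kappa(\delta,\epsilon)\,\nu$. $M$ is $(\epsilon,\delta)$-differentially private if $\mathbb P(M(x)\in S)\le e^\epsilon\,\mathbb P(M(x')\in S)+\delta$ for all adjacent $x,x'$ and all $S$ in the $\sigma$-algebra on output sequences generated by the finite-dimensional (Borel) cylinder sets. *)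

theory Defs
  imports
    "HOL-Probability.Probability"
    "Jordan_Normal_Form.Spectral_Radius"
    "Jordan_Normal_Form.DL_Rank"
begin

no_notation Finite_Cartesian_Product.vec_nth (infixl "$" 90)
no_notation Inner_Product.real_inner_class.inner (infix "\<bullet>" 70)

text \<open>
  The systems may have different dimensions, so vectors and matrices are the dimension-carrying
  types of Jordan_Normal_Form. Coordinates are numbered from 0, and a signal in dimension
  \<open>d\<close> is a function \<open>nat \<Rightarrow> real vec\<close> with values in \<open>carrier_vec d\<close>.
\<close>

subsection \<open>Signals and their norm\<close>

definition l2_signal :: "(nat \<Rightarrow> real vec) \<Rightarrow> bool" where
  "l2_signal u \<longleftrightarrow> summable (\<lambda>t. u t \<bullet> u t)"

definition l2_norm :: "(nat \<Rightarrow> real vec) \<Rightarrow> real" where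
  "l2_norm u = sqrt (\<Sum>t. u t \<bullet> u t)"

text \<open>The Borel sets of $\mathbb{R}^d$, carried over to \<open>carrier_vec d\<close> along the coordinate
  bijection, and the cylinder $\sigma$-algebra on signals.\<close>

definition borel_vec :: "nat \<Rightarrow> real vec measure" where
  "borel_vec d = vimage_algebra (carrier_vec d) (\<lambda>v. \<lambda>j\<in>{..<d}. v $ j) (\<Pi>\<^sub>M j\<in>{..<d}. borel)"

definition signal_space :: "nat \<Rightarrow> (nat \<Rightarrow> real vec) measure" where
  "signal_space d = (\<Pi>\<^sub>M t\<in>UNIV. borel_vec d)"

subsection \<open>Linear systems\<close>

definition schur_stable :: "real mat \<Rightarrow> bool" where
  "schur_stable A \<longleftrightarrow> (\<forall>z. eigenvalue (map_mat complex_of_real A) z \<longrightarrow> cmod z < 1)"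

definition stabilizable :: "real mat \<Rightarrow> real mat \<Rightarrow> bool" where
  "stabilizable A B \<longleftrightarrow> (\<exists>F \<in> carrier_mat (dim_col B) (dim_row A). schur_stable (A + B * F))"

definition detectable :: "real mat \<Rightarrow> real mat \<Rightarrow> bool" where
  "detectable A C \<longleftrightarrow> (\<exists>H \<in> carrier_mat (dim_row A) (dim_row C). schur_stable (A - H * C))"

definition full_row_rank :: "real mat \<Rightarrow> bool" where
  "full_row_rank D \<longleftrightarrow> vec_space.rank (dim_row D) D = dim_row D"

definition selection_mat :: "nat \<Rightarrow> nat set \<Rightarrow> real mat" where
  "selection_mat d J = mat d d (\<lambda>(j, k). if j = k \<and> j \<in> J then 1 else 0)"

subsection \<open>Steady-state Kalman filter\<close>

definition innovation_cov :: "real mat \<Rightarrow> real mat \<Rightarrow> real mat \<Rightarrow> real mat" where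
  "innovation_cov C D \<Sigma> = C * \<Sigma> * C\<^sup>T + D * D\<^sup>T"

definition prediction_gain ::
  "real mat \<Rightarrow> real mat \<Rightarrow> real mat \<Rightarrow> real mat \<Rightarrow> real mat \<Rightarrow> real mat" where
  "prediction_gain A B C D \<Sigma> =
     (A * \<Sigma> * C\<^sup>T + B * D\<^sup>T) * the (mat_inverse (innovation_cov C D \<Sigma>))"

definition filter_gain :: "real mat \<Rightarrow> real mat \<Rightarrow> real mat \<Rightarrow> real mat" where
  "filter_gain C D \<Sigma> = \<Sigma> * C\<^sup>T * the (mat_inverse (innovation_cov C D \<Sigma>))"

text \<open>The stabilizing solution, if it exists, is unique and positive semidefinite. Its existence
  does not follow from detectability and stabilizability when the noises are correlated
  ($B D^T \neq 0$).\<close>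

definition stabilizing_riccati_solution ::
  "real mat \<Rightarrow> real mat \<Rightarrow> real mat \<Rightarrow> real mat \<Rightarrow> real mat \<Rightarrow> bool" where
  "stabilizing_riccati_solution A B C D \<Sigma> \<longleftrightarrow>
     \<Sigma> \<in> carrier_mat (dim_row A) (dim_row A) \<and> \<Sigma>\<^sup>T = \<Sigma> \<and>
     invertible_mat (innovation_cov C D \<Sigma>) \<and>
     \<Sigma> = A * \<Sigma> * A\<^sup>T + B * B\<^sup>T - prediction_gain A B C D \<Sigma> * (A * \<Sigma> * C\<^sup>T + B * D\<^sup>T)\<^sup>T \<and>
     schur_stable (A - prediction_gain A B C D \<Sigma> * C)"

primrec kalman_prediction ::
  "real mat \<Rightarrow> real mat \<Rightarrow> real mat \<Rightarrow> real mat \<Rightarrow> real mat \<Rightarrow> real vec \<Rightarrow>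
   (nat \<Rightarrow> real vec) \<Rightarrow> nat \<Rightarrow> real vec" where
  "kalman_prediction A B C D \<Sigma> \<xi> y 0 = \<xi>"
| "kalman_prediction A B C D \<Sigma> \<xi> y (Suc t) =
     A *\<^sub>v kalman_prediction A B C D \<Sigma> \<xi> y t +
     prediction_gain A B C D \<Sigma> *\<^sub>v (y t - C *\<^sub>v kalman_prediction A B C D \<Sigma> \<xi> y t)"

definition kalman_filter ::
  "real mat \<Rightarrow> real mat \<Rightarrow> real mat \<Rightarrow> real mat \<Rightarrow> real mat \<Rightarrow> real vec \<Rightarrow>
   (nat \<Rightarrow> real vec) \<Rightarrow> nat \<Rightarrow> real vec" where
  "kalman_filter A B C D \<Sigma> \<xi> y t =
     kalman_prediction A B C D \<Sigma> \<xi> y t +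
     filter_gain C D \<Sigma> *\<^sub>v (y t - C *\<^sub>v kalman_prediction A B C D \<Sigma> \<xi> y t)"

subsection \<open>Transfer functions\<close>

definition impulse :: "nat \<Rightarrow> nat \<Rightarrow> nat \<Rightarrow> real vec" where
  "impulse m k t = (if t = 0 then unit_vec m k else 0\<^sub>v m)"

text \<open>The z-transform of the matrix impulse response of the causal linear time-invariant map
  \<open>F\<close> from signals in dimension \<open>m\<close> to signals in dimension \<open>r\<close>.\<close>

definition transfer_function ::
  "nat \<Rightarrow> nat \<Rightarrow> ((nat \<Rightarrow> real vec) \<Rightarrow> nat \<Rightarrow> real vec) \<Rightarrow> complex \<Rightarrow> complex mat" where
  "transfer_function r m F z =
     mat r m (\<lambda>(j, k). \<Sum>t. complex_of_real (F (impulse m k) t $ j) * inverse z ^ t)"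

definition singular_values :: "complex mat \<Rightarrow> real set" where
  "singular_values G = {s. 0 \<le> s \<and> eigenvalue (mat_adjoint G * G) (complex_of_real (s\<^sup>2))}"

definition sigma_max :: "complex mat \<Rightarrow> real" where
  "sigma_max G = Max (singular_values G)"

definition hinf_norm :: "(complex \<Rightarrow> complex mat) \<Rightarrow> real" where
  "hinf_norm G =
     real_of_ereal (esssup (restrict_space lborel {-pi..<pi}) (\<lambda>\<omega>. ereal (sigma_max (G (cis \<omega>)))))"

text \<open>The map $v \mapsto L \mathcal{K} (C S v)$ with zero initial condition.\<close>

definition sensitivity_map ::
  "real mat \<Rightarrow> real mat \<Rightarrow> real mat \<Rightarrow> real mat \<Rightarrow> real mat \<Rightarrow> real mat \<Rightarrow> real mat \<Rightarrow>
   (nat \<Rightarrow> real vec) \<Rightarrow> nat \<Rightarrow> real vec" where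
  "sensitivity_map A B C D L \<Sigma> S v t =
     L *\<^sub>v kalman_filter A B C D \<Sigma> (0\<^sub>v (dim_row A)) (\<lambda>s. C *\<^sub>v (S *\<^sub>v v s)) t"

subsection \<open>Gaussian processes\<close>

text \<open>The law may be degenerate.\<close>

definition gaussian_vector :: "'a measure \<Rightarrow> nat \<Rightarrow> real vec \<Rightarrow> ('a \<Rightarrow> real vec) \<Rightarrow> bool" where
  "gaussian_vector P d m X \<longleftrightarrow>
     m \<in> carrier_vec d \<and> X \<in> measurable P (borel_vec d) \<and>
     (\<forall>a \<in> carrier_vec d. \<exists>\<sigma>\<ge>0.
        distr P borel (\<lambda>\<omega>. a \<bullet> X \<omega>) =
          (if \<sigma> = 0 then return borel (a \<bullet> m) else density lborel (normal_density (a \<bullet> m) \<sigma>)))"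

definition standard_white_noise :: "'a measure \<Rightarrow> nat \<Rightarrow> ('a \<Rightarrow> nat \<Rightarrow> real vec) \<Rightarrow> bool" where
  "standard_white_noise P d W \<longleftrightarrow>
     W \<in> measurable P (signal_space d) \<and>
     (\<forall>t. \<forall>j<d. distributed P lborel (\<lambda>\<omega>. W \<omega> t $ j) (\<lambda>z. ennreal (std_normal_density z))) \<and>
     prob_space.indep_vars P (\<lambda>_. borel) (\<lambda>(t, j) \<omega>. W \<omega> t $ j) (UNIV \<times> {..<d})"

text \<open>The library's \<open>indep_var\<close> requires both variables to have the same type.\<close>

definition indep_rv ::
  "'a measure \<Rightarrow> 'b measure \<Rightarrow> ('a \<Rightarrow> 'b) \<Rightarrow> 'c measure \<Rightarrow> ('a \<Rightarrow> 'c) \<Rightarrow> bool" where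
  "indep_rv P M X N Y \<longleftrightarrow>
     X \<in> measurable P M \<and> Y \<in> measurable P N \<and>
     prob_space.indep_set P
       (sets (vimage_algebra (space P) X M)) (sets (vimage_algebra (space P) Y N))"

subsection \<open>Differential privacy\<close>

definition Qfun :: "real \<Rightarrow> real" where
  "Qfun x = 1 / sqrt (2 * pi) * (LINT u:{x..}|lborel. exp (- (u\<^sup>2) / 2))"

definition Qinv :: "real \<Rightarrow> real" where
  "Qinv \<delta> = (THE x. Qfun x = \<delta>)"

definition kappa :: "real \<Rightarrow> real \<Rightarrow> real" where
  "kappa \<delta> \<epsilon> = 1 / (2 * \<epsilon>) * (Qinv \<delta> + sqrt ((Qinv \<delta>)\<^sup>2 + 2 * \<epsilon>))"

definition differentially_private ::
  "'a measure \<Rightarrow> 'o measure \<Rightarrow> ('x \<Rightarrow> 'x \<Rightarrow> bool) \<Rightarrow> ('x \<Rightarrow> 'a \<Rightarrow> 'o) \<Rightarrow> real \<Rightarrow> real \<Rightarrow> bool" where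
  "differentially_private P N Adj M \<epsilon> \<delta> \<longleftrightarrow>
     (\<forall>x x'. Adj x x' \<longrightarrow> (\<forall>S \<in> sets N.
        measure P {\<omega> \<in> space P. M x \<omega> \<in> S}
          \<le> exp \<epsilon> * measure P {\<omega> \<in> space P. M x' \<omega> \<in> S} + \<delta>))"

text \<open>A global trajectory \<open>x\<close> assigns to system \<open>i\<close> and time \<open>t\<close> the state \<open>x i t\<close>.\<close>

definition trajectories :: "nat \<Rightarrow> (nat \<Rightarrow> nat) \<Rightarrow> (nat \<Rightarrow> nat \<Rightarrow> real vec) set" where
  "trajectories n d = {x. \<forall>i\<in>{1..n}. \<forall>t. x i t \<in> carrier_vec (d i)}"

definition adjacent ::
  "nat \<Rightarrow> (nat \<Rightarrow> nat) \<Rightarrow> (nat \<Rightarrow> real mat) \<Rightarrow> (nat \<Rightarrow> real) \<Rightarrow>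
   (nat \<Rightarrow> nat \<Rightarrow> real vec) \<Rightarrow> (nat \<Rightarrow> nat \<Rightarrow> real vec) \<Rightarrow> bool" where
  "adjacent n d S \<rho> x x' \<longleftrightarrow>
     x \<in> trajectories n d \<and> x' \<in> trajectories n d \<and>
     (\<exists>i\<in>{1..n}.
        l2_signal (\<lambda>t. S i *\<^sub>v x i t - S i *\<^sub>v x' i t) \<and>
        l2_norm (\<lambda>t. S i *\<^sub>v x i t - S i *\<^sub>v x' i t) \<le> \<rho> i \<and>
        (\<forall>t. (1\<^sub>m (d i) - S i) *\<^sub>v x i t = (1\<^sub>m (d i) - S i) *\<^sub>v x' i t) \<and>
        (\<forall>j\<in>{1..n}. j \<noteq> i \<longrightarrow> (\<forall>t. x j t = x' j t)))"

text \<open>The released signal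
  $\sum_{i=1}^n L_i \mathcal{K}_i (C_i x_i + v_i) + c\,\nu$ in dimension \<open>r\<close>, where \<open>\<xi> i\<close> is the initial
  condition of the \<open>i\<close>-th filter.\<close>

definition released_signal ::
  "nat \<Rightarrow> nat \<Rightarrow> (nat \<Rightarrow> real mat) \<Rightarrow> (nat \<Rightarrow> real mat) \<Rightarrow> (nat \<Rightarrow> real mat) \<Rightarrow>
   (nat \<Rightarrow> real mat) \<Rightarrow> (nat \<Rightarrow> real mat) \<Rightarrow> (nat \<Rightarrow> real mat) \<Rightarrow> (nat \<Rightarrow> real vec) \<Rightarrow>
   (nat \<Rightarrow> nat \<Rightarrow> real vec) \<Rightarrow> real \<Rightarrow> (nat \<Rightarrow> real vec) \<Rightarrow>
   (nat \<Rightarrow> nat \<Rightarrow> real vec) \<Rightarrow> nat \<Rightarrow> real vec" where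
  "released_signal n r A B C D L \<Sigma> \<xi> v c \<nu> x t =
     vec r (\<lambda>j. \<Sum>i=1..n.
       (L i *\<^sub>v kalman_filter (A i) (B i) (C i) (D i) (\<Sigma> i) (\<xi> i)
                  (\<lambda>s. C i *\<^sub>v x i s + v i s) t) $ j) + c \<cdot>\<^sub>v \<nu> t"

end

theory Submission
  imports Defs
begin

text \<open>
  For adjacent trajectories the noise-free outputs differ by the response of the stable system
  $L \mathcal{K} C S$ to the difference of the states. Its impulse response is absolutely summable,
  so by Parseval and the definition of the $\mathcal{H}_\infty$ norm the $\ell^2$ norm of the response
  is at most $\gamma_i \rho_i$; causality lets one truncate the input in time, so that only finite
  inputs have to be transformed. On finitely many coordinates the output laws are Gaussian with means
  at distance at most $\gamma$, and the log-likelihood ratio exceeds $\epsilon$ with probability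
  $\mathcal{Q}(\epsilon/\sigma - \sigma/2)$, where $\sigma \le 1/\kappa$ is the distance in units of the noise;
  \<open>kappa\<close> is the positive root of $\epsilon\kappa - 1/(2\kappa) = \mathcal{Q}^{-1}(\delta)$. The bound passes
  from cylinder sets to the whole $\sigma$-algebra by approximation.
\<close>

subsection \<open>Gaussian shifts\<close>

text \<open>A filter with initial condition \<open>\<xi>\<close> is affine, not linear. Both
  trajectories use the same \<open>\<xi>\<close> and the same realization of the measurement noise,
  so these cancel and the difference passes through the filter from the zero state. Equality of the
  unselected coordinates makes the state difference a fixed vector of \<open>S\<close>; this is how
  the factor \<open>S\<close> enters the transfer function. \<open>hinf_norm\<close> is assembled
  from total operators, \<open>Max\<close> over singular values and \<open>real_of_ereal\<close> of
  an essential supremum. It is an actual bound only once the largest eigenvalue of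
  \<open>mat_adjoint G * G\<close> is known to exist and the supremum, of a measurable function, to
  be finite; much of the linear algebra and analysis serves this purpose. If \<gamma> = 0, no noise
  is added and there are no Gaussian densities to compare. The theorem therefore distinguishes
  whether the two noise-free outputs agree; if they differ, the gain bound forces \<gamma> >
  0.\<close>

abbreviation std_gaussian :: "real measure" where
  "std_gaussian \<equiv> density lborel (\<lambda>x. ennreal (std_normal_density x))"

lemma prob_space_std_gaussian: "prob_space std_gaussian"
  by (rule prob_space_normal_density) simp

lemma real_distribution_std_gaussian: "real_distribution std_gaussian"
  using prob_space_std_gaussian
  by (simp add: real_distribution_def real_distribution_axioms_def)

lemma Qfun_eq_measure: "Qfun x = measure std_gaussian {x..}"
proof -
  have "Qfun x = (LINT u:{x..}|lborel. std_normal_density u)"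
    unfolding Qfun_def set_lebesgue_integral_def std_normal_density_def
    by (subst integral_mult_right_zero[symmetric])
       (auto intro!: Bochner_Integration.integral_cong simp: mult_ac)
  also have "\<dots> = measure std_gaussian {x..}"
  proof -
    have "measure std_gaussian {x..} = (\<integral>u. indicator {x..} u \<partial>std_gaussian)" by simp
    also have "\<dots> = (\<integral>u. std_normal_density u *\<^sub>R indicator {x..} u \<partial>lborel)"
      by (rule integral_density) auto
    finally show ?thesis by (simp add: set_lebesgue_integral_def mult.commute)
  qed
  finally show ?thesis .
qed

lemma Qfun_eq_cdf: "Qfun x = 1 - cdf std_gaussian x"
proof -
  interpret prob_space std_gaussian by (rule prob_space_std_gaussian)
  have "Qfun x = prob {x..}" by (rule Qfun_eq_measure)
  also have "{x..} = {x} \<union> {x<..}" by auto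
  also have "prob ({x} \<union> {x<..}) = prob {x} + prob {x<..}"
    by (intro finite_measure_Union) auto
  also have "prob {x} = 0"
    by (simp add: measure_def emeasure_density nn_integral_indicator_singleton)
  also have "{x<..} = space std_gaussian - {..x}" by auto
  also have "prob \<dots> = 1 - prob {..x}" by (intro prob_compl) auto
  finally show ?thesis by (simp add: cdf_def)
qed

text \<open>The density vanishes nowhere, so an interval of positive length has positive mass.
  Strictness is what makes the description in \<open>Qinv\<close> unique.\<close>

lemma Qfun_strict_antimono:
  assumes "x < y" shows "Qfun y < Qfun x"
proof -
  interpret prob_space std_gaussian by (rule prob_space_std_gaussian)
  have split: "{x..} = {x..<y} \<union> {y..}" using assms by auto
  have "Qfun x = prob {x..<y} + Qfun y"
    unfolding Qfun_eq_measure split by (intro finite_measure_Union) auto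
  moreover have "prob {x..<y} \<noteq> 0"
  proof
    assume "prob {x..<y} = 0"
    then have "emeasure std_gaussian {x..<y} = 0" by (simp add: emeasure_eq_measure)
    then have "AE z in lborel. z \<in> {x..<y} \<longrightarrow> std_normal_density z \<le> 0"
      by (subst (asm) emeasure_density) (auto simp: nn_integral_0_iff_AE indicator_def)
    then have "AE z in lborel. z \<notin> {x..<y}"
      by eventually_elim (use normal_density_pos[of 1 0] in \<open>auto simp: not_le[symmetric]\<close>)
    then have "emeasure lborel {x..<y} = 0"
      by (subst (asm) AE_iff_measurable[where N="{x..<y}"]) auto
    then show False using assms by simp
  qed
  ultimately show ?thesis using measure_nonneg[of std_gaussian "{x..<y}"] by linarith
qed

lemma Qfun_antimono: "x \<le> y \<Longrightarrow> Qfun y \<le> Qfun x"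
  using Qfun_strict_antimono by (cases "x = y") (auto simp: less_le)

text \<open>The normal law has no atoms, so its distribution function is continuous and the
  intermediate value theorem solves \<open>Qfun x = \<delta>\<close>; strict monotonicity identifies
  the solution with \<open>Qinv \<delta>\<close>.\<close>

lemma Qfun_Qinv:
  assumes "0 < \<delta>" "\<delta> < 1" shows "Qfun (Qinv \<delta>) = \<delta>"
proof -
  interpret real_distribution std_gaussian by (rule real_distribution_std_gaussian)
  have cont: "isCont (cdf std_gaussian) x" for x
    by (simp add: isCont_cdf measure_def emeasure_density nn_integral_indicator_singleton)
  have "eventually (\<lambda>x. cdf std_gaussian x > 1 - \<delta>) at_top"
    using cdf_lim_at_top_prob assms by (intro order_tendstoD) auto
  then obtain b where b: "\<And>x. x \<ge> b \<Longrightarrow> cdf std_gaussian x > 1 - \<delta>"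
    by (auto simp: eventually_at_top_linorder)
  have "eventually (\<lambda>x. cdf std_gaussian x < 1 - \<delta>) at_bot"
    using cdf_lim_at_bot assms by (intro order_tendstoD) auto
  then obtain a where a: "\<And>x. x \<le> a \<Longrightarrow> cdf std_gaussian x < 1 - \<delta>"
    by (auto simp: eventually_at_bot_linorder)
  \<comment> \<open>\<open>min a b\<close> orders the endpoints, since nothing so far relates
    \<open>a\<close> and \<open>b\<close>.\<close>
  have "\<exists>x\<ge>min a b. x \<le> b \<and> cdf std_gaussian x = 1 - \<delta>"
    using a[of "min a b"] b[of b] cont by (intro IVT) auto
  then obtain x where "cdf std_gaussian x = 1 - \<delta>" by blast
  then have x: "Qfun x = \<delta>" unfolding Qfun_eq_cdf by simp
  have "Qinv \<delta> = x"
    unfolding Qinv_def using x Qfun_strict_antimono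
    by (intro the_equality) (metis linorder_neq_iff)+
  with x show ?thesis by simp
qed

text \<open>The square root exceeds the modulus of \<open>Qinv \<delta>\<close>, so the sum is
  positive whatever the sign of \<open>Qinv \<delta>\<close>.\<close>

lemma kappa_pos: assumes "\<epsilon> > 0" shows "kappa \<delta> \<epsilon> > 0"
proof -
  have "\<bar>Qinv \<delta>\<bar> < sqrt ((Qinv \<delta>)\<^sup>2 + 2 * \<epsilon>)"
    using assms by (metis real_sqrt_abs real_sqrt_less_iff less_add_same_cancel1 mult_pos_pos zero_less_numeral)
  then show ?thesis using assms by (simp add: kappa_def)
qed

lemma kappa_quadratic:
  assumes "\<epsilon> > 0" shows "\<epsilon> * kappa \<delta> \<epsilon> - 1 / (2 * kappa \<delta> \<epsilon>) = Qinv \<delta>"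
proof -
  define s where "s = sqrt ((Qinv \<delta>)\<^sup>2 + 2 * \<epsilon>)"
  have s2: "s\<^sup>2 = (Qinv \<delta>)\<^sup>2 + 2 * \<epsilon>" using assms by (simp add: s_def)
  have k: "2 * \<epsilon> * kappa \<delta> \<epsilon> = Qinv \<delta> + s" using assms by (simp add: kappa_def s_def)
  have "(2 * \<epsilon> * kappa \<delta> \<epsilon> - Qinv \<delta>)\<^sup>2 = (Qinv \<delta>)\<^sup>2 + 2 * \<epsilon>" using k s2 by simp
  then have "2 * \<epsilon> * (2 * \<epsilon> * (kappa \<delta> \<epsilon>)\<^sup>2 - 2 * kappa \<delta> \<epsilon> * Qinv \<delta>  - 1) = 0"
    by (simp add: power2_eq_square algebra_simps)
  then have "2 * \<epsilon> * (kappa \<delta> \<epsilon>)\<^sup>2 - 2 * kappa \<delta> \<epsilon> * Qinv \<delta>  - 1 = 0" using assms by simp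
  then show ?thesis using kappa_pos[OF assms, of \<delta>]
    by (simp add: field_simps power2_eq_square)
qed

text \<open>The threshold \<epsilon> / \<sigma> - \<sigma> / 2 decreases in \<sigma>, and at
  \<sigma> = 1 / \<open>kappa \<delta> \<epsilon>\<close> it equals \<open>Qinv \<delta>\<close> by
  \<open>kappa_quadratic\<close>.\<close>

lemma Qfun_kappa_le:
  assumes "\<epsilon> > 0" "0 < \<delta>" "\<delta> < 1" "0 < \<sigma>" "\<sigma> * kappa \<delta> \<epsilon> \<le> 1"
  shows "Qfun (\<epsilon> / \<sigma> - \<sigma> / 2) \<le> \<delta>"
proof -
  note k = kappa_pos[OF assms(1), of \<delta>]
  have "kappa \<delta> \<epsilon> \<le> 1 / \<sigma>" "\<sigma> \<le> 1 / kappa \<delta> \<epsilon>" using assms k by (simp_all add: field_simps)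
  then have "\<epsilon> * kappa \<delta> \<epsilon> \<le> \<epsilon> * (1 / \<sigma>)" "\<sigma> / 2 \<le> 1 / kappa \<delta> \<epsilon> / 2"
    using assms by (intro mult_left_mono divide_right_mono; simp)+
  then have "Qinv \<delta> \<le> \<epsilon> / \<sigma> - \<sigma> / 2"
    unfolding kappa_quadratic[OF assms(1), of \<delta>, symmetric] by simp
  then show ?thesis using Qfun_antimono Qfun_Qinv assms by metis
qed

section \<open>Product densities and the likelihood ratio of a Gaussian shift\<close>

text \<open>Both sides agree on boxes, because the integral of a product of one-variable functions
  over a product measure factorises; boxes determine a finite product measure.\<close>

lemma (in product_sigma_finite) PiM_density:
  assumes I: "finite I"
    and f [measurable]: "\<And>i. i \<in> I \<Longrightarrow> f i \<in> borel_measurable (M i)"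
    and sf: "\<And>i. sigma_finite_measure (density (M i) (f i))"
  shows "PiM I (\<lambda>i. density (M i) (f i)) = density (PiM I M) (\<lambda>x. \<Prod>i\<in>I. f i (x i))"
proof -
  interpret D: product_sigma_finite "\<lambda>i. density (M i) (f i)"
    using sf by (simp add: product_sigma_finite_def)
  show ?thesis
  proof (rule D.PiM_eqI[symmetric, OF I])
    show "sets (density (PiM I M) (\<lambda>x. \<Prod>i\<in>I. f i (x i))) = sets (PiM I (\<lambda>i. density (M i) (f i)))"
      by (auto intro!: sets_PiM_cong)
    fix A assume "\<And>i. i \<in> I \<Longrightarrow> A i \<in> sets (density (M i) (f i))"
    then have A [measurable]: "\<And>i. i \<in> I \<Longrightarrow> A i \<in> sets (M i)" by simp
    have [measurable]: "Pi\<^sub>E I A \<in> sets (PiM I M)" using A I by (intro sets_PiM_I_finite) auto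
    have ind: "indicator (Pi\<^sub>E I A) x = (\<Prod>i\<in>I. indicator (A i) (x i) :: ennreal)"
      if "x \<in> space (PiM I M)" for x
      using that I by (auto simp: indicator_def space_PiM PiE_iff split: if_splits)
    have m: "(\<lambda>x. \<Prod>i\<in>I. f i (x i)) \<in> borel_measurable (PiM I M)"
      using f by measurable
    have "emeasure (density (PiM I M) (\<lambda>x. \<Prod>i\<in>I. f i (x i))) (Pi\<^sub>E I A)
        = (\<integral>\<^sup>+x. (\<Prod>i\<in>I. f i (x i) * indicator (A i) (x i)) \<partial>PiM I M)"
      using m by (subst emeasure_density) (auto intro!: nn_integral_cong simp: ind prod.distrib)
    also have "\<dots> = (\<Prod>i\<in>I. \<integral>\<^sup>+x. f i x * indicator (A i) x \<partial>M i)"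
      using f A by (intro product_nn_integral_prod I borel_measurable_times_ennreal borel_measurable_indicator) auto
    also have "\<dots> = (\<Prod>i\<in>I. emeasure (density (M i) (f i)) (A i))"
      using f A by (intro prod.cong) (auto simp: emeasure_density)
    finally show "emeasure (density (PiM I M) (\<lambda>x. \<Prod>i\<in>I. f i (x i))) (Pi\<^sub>E I A)
        = (\<Prod>i\<in>I. emeasure (density (M i) (f i)) (A i))" .
  qed
qed

text \<open>Completing the square gives the Cameron-Martin factor of a shift. The shifted law is
  written relative to the centred one, so that the product of these factors is directly the
  likelihood ratio.\<close>

lemma shifted_gaussian_density:
  "density lborel (\<lambda>x. ennreal (normal_density h 1 x)) =
   density std_gaussian (\<lambda>x. ennreal (exp (h * x - h\<^sup>2 / 2)))"
proof -
  have "normal_density h 1 x = std_normal_density x * exp (h * x - h\<^sup>2 / 2)" for x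
  proof -
    have "- (x - h)\<^sup>2 / 2 = - x\<^sup>2 / 2 + (h * x - h\<^sup>2 / 2)" by (simp add: power2_eq_square field_simps)
    then show ?thesis by (simp add: normal_density_def mult_exp_exp)
  qed
  then show ?thesis
    by (subst density_density_eq) (auto simp: ennreal_mult' intro!: density_cong)
qed

lemma (in prob_space) prob_std_normal_ge:
  assumes "distributed M lborel X (\<lambda>x. ennreal (std_normal_density x))"
  shows "prob {\<omega>\<in>space M. a \<le> X \<omega>} = Qfun a"
proof -
  have X: "X \<in> measurable M lborel" using distributed_measurable[OF assms] .
  have "Qfun a = measure (distr M lborel X) {a..}"
    by (simp add: Qfun_eq_measure distributed_distr_eq_density[OF assms])
  also have "\<dots> = prob (X -` {a..} \<inter> space M)" by (rule measure_distr[OF X]) auto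
  also have "X -` {a..} \<inter> space M = {\<omega>\<in>space M. a \<le> X \<omega>}" by auto
  finally show ?thesis by simp
qed

lemma (in prob_space) linear_form_std_normal:
  assumes "finite I" "indep_vars (\<lambda>_. borel) Z I"
    and Z: "\<And>i. i \<in> I \<Longrightarrow> distributed M lborel (Z i) (\<lambda>x. ennreal (std_normal_density x))"
    and pos: "(\<Sum>i\<in>I. (h i)\<^sup>2) > 0"
  shows "distributed M lborel (\<lambda>\<omega>. (\<Sum>i\<in>I. h i * Z i \<omega>) / sqrt (\<Sum>i\<in>I. (h i)\<^sup>2))
    (\<lambda>x. ennreal (std_normal_density x))"
proof -
  \<comment> \<open>\<open>sum_indep_normal\<close> demands positive standard deviations, so terms
    with a zero coefficient are dropped; positivity of the sum of squares keeps the rest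
    nonempty.\<close>
  define I' where "I' = {i\<in>I. h i \<noteq> 0}"
  have I': "finite I'" "I' \<subseteq> I" using assms by (auto simp: I'_def)
  have s: "(\<Sum>i\<in>I'. g i) = (\<Sum>i\<in>I. g i)" if "\<And>i. h i = 0 \<Longrightarrow> g i = 0" for g :: "'b \<Rightarrow> real"
    using assms(1) that by (intro sum.mono_neutral_left) (auto simp: I'_def)
  have "(\<Sum>i\<in>I'. (h i)\<^sup>2) > 0" using pos by (subst s) auto
  then have ne: "I' \<noteq> {}" by auto
  have ind: "indep_vars (\<lambda>_. borel) (\<lambda>i \<omega>. h i * Z i \<omega>) I'"
    using indep_vars_compose2[OF indep_vars_subset[OF assms(2) I'(2)], of "\<lambda>i x. h i * x" "\<lambda>_. borel"]
    by simp
  have "distributed M lborel (\<lambda>\<omega>. h i * Z i \<omega>) (normal_density 0 \<bar>h i\<bar>)" if "i \<in> I'" for i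
    using normal_density_affine[OF Z[of i], of "h i" 0] that by (auto simp: I'_def)
  from sum_indep_normal[OF I'(1) ne ind _ this]
  have "distributed M lborel (\<lambda>\<omega>. \<Sum>i\<in>I'. h i * Z i \<omega>)
     (normal_density (\<Sum>i\<in>I'. 0) (sqrt (\<Sum>i\<in>I'. \<bar>h i\<bar>\<^sup>2)))"
    by (auto simp: I'_def)
  then have "distributed M lborel (\<lambda>\<omega>. \<Sum>i\<in>I. h i * Z i \<omega>)
     (normal_density 0 (sqrt (\<Sum>i\<in>I. (h i)\<^sup>2)))"
    by (simp add: s)
  then show ?thesis
    using normal_standard_normal_convert[of "sqrt (\<Sum>i\<in>I. (h i)\<^sup>2)" "\<lambda>\<omega>. \<Sum>i\<in>I. h i * Z i \<omega>" 0] pos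
    by simp
qed

text \<open>The log-likelihood ratio of the shifted law to the centred one at x is <h, x> -
  \<sigma>^2 / 2. On the set \<open>E\<close> where it is at most \<epsilon>, integrating the
  density gives the factor exp \<epsilon>. Under the shifted law the ratio becomes <h, Z> +
  \<sigma>^2 / 2, where <h, Z> / \<sigma> is standard normal; so the mass outside \<open>E\<close>
  is at most the normal tail beyond \<epsilon> / \<sigma> - \<sigma> / 2.\<close>

lemma (in prob_space) gaussian_shift_privacy:
  assumes I: "finite I" and ind: "indep_vars (\<lambda>_. borel) Z I"
    and Z: "\<And>i. i \<in> I \<Longrightarrow> distributed M lborel (Z i) (\<lambda>x. ennreal (std_normal_density x))"
    and \<sigma>: "\<sigma> = sqrt (\<Sum>i\<in>I. (h i)\<^sup>2)" "\<sigma> > 0"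
    and B: "B \<in> sets (PiM I (\<lambda>_. borel))"
  shows "prob {\<omega>\<in>space M. (\<lambda>i\<in>I. Z i \<omega> + h i) \<in> B}
     \<le> exp \<epsilon> * prob {\<omega>\<in>space M. (\<lambda>i\<in>I. Z i \<omega>) \<in> B} + Qfun (\<epsilon> / \<sigma> - \<sigma> / 2)"
proof -
  have ne: "I \<noteq> {}" using \<sigma> by auto
  have Zm [measurable]: "\<And>i. i \<in> I \<Longrightarrow> Z i \<in> borel_measurable M"
    using distributed_measurable[OF Z] by simp
  let ?\<mu> = "PiM I (\<lambda>_. std_gaussian)"
  let ?B = "PiM I (\<lambda>_. borel :: real measure)"
  have sets_\<mu>: "sets ?\<mu> = sets ?B" by (intro sets_PiM_cong) auto
  interpret G: product_sigma_finite "\<lambda>i. std_gaussian"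
    using prob_space_std_gaussian by (simp add: product_sigma_finite_def prob_space_imp_sigma_finite)
  interpret GP: prob_space ?\<mu> by (intro prob_space_PiM prob_space_std_gaussian)
  have s2: "\<sigma>\<^sup>2 = (\<Sum>i\<in>I. (h i)\<^sup>2)" using \<sigma> by (simp add: sum_nonneg)
  have Z1m [measurable]: "(\<lambda>\<omega>. \<lambda>i\<in>I. Z i \<omega>) \<in> measurable M ?B" by measurable
  have Z2m [measurable]: "(\<lambda>\<omega>. \<lambda>i\<in>I. Z i \<omega> + h i) \<in> measurable M ?B" by measurable
  have law1: "distr M ?B (\<lambda>\<omega>. \<lambda>i\<in>I. Z i \<omega>) = ?\<mu>"
  proof -
    have "distr M ?B (\<lambda>\<omega>. \<lambda>i\<in>I. Z i \<omega>) = PiM I (\<lambda>i. distr M borel (Z i))"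
      using indep_vars_iff_distr_eq_PiM'[OF ne, of Z "\<lambda>_. borel"] ind by simp
    also have "\<dots> = ?\<mu>"
      using distributed_distr_eq_density[OF Z]
      by (intro PiM_cong) (auto simp: distr_cong[OF refl sets_lborel[symmetric]])
    finally show ?thesis .
  qed
  have law2: "distr M ?B (\<lambda>\<omega>. \<lambda>i\<in>I. Z i \<omega> + h i)
      = density ?\<mu> (\<lambda>x. \<Prod>i\<in>I. ennreal (exp (h i * x i - (h i)\<^sup>2 / 2)))"
  proof -
    have ind2: "indep_vars (\<lambda>_. borel) (\<lambda>i \<omega>. Z i \<omega> + h i) I"
      using indep_vars_compose2[OF ind, of "\<lambda>i x. x + h i" "\<lambda>_. borel"] by simp
    have "distributed M lborel (\<lambda>\<omega>. Z i \<omega> + h i) (\<lambda>x. ennreal (normal_density (h i) 1 x))"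
      if "i \<in> I" for i
      using normal_density_affine[OF Z[OF that], of 1 "h i"] by (simp add: add.commute)
    from distributed_distr_eq_density[OF this]
    have d: "distr M borel (\<lambda>\<omega>. Z i \<omega> + h i) = density std_gaussian (\<lambda>x. ennreal (exp (h i * x - (h i)\<^sup>2 / 2)))"
      if "i \<in> I" for i
      unfolding shifted_gaussian_density[symmetric] using that by (auto simp: distr_cong[OF refl sets_lborel[symmetric]])
    have "distr M ?B (\<lambda>\<omega>. \<lambda>i\<in>I. Z i \<omega> + h i) = PiM I (\<lambda>i. distr M borel (\<lambda>\<omega>. Z i \<omega> + h i))"
      using indep_vars_iff_distr_eq_PiM'[OF ne, of "\<lambda>i \<omega>. Z i \<omega> + h i" "\<lambda>_. borel"] ind2 by simp
    also have "\<dots> = PiM I (\<lambda>i. density std_gaussian (\<lambda>x. ennreal (exp (h i * x - (h i)\<^sup>2 / 2))))"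
      using d by (intro PiM_cong) auto
    also have "\<dots> = density ?\<mu> (\<lambda>x. \<Prod>i\<in>I. ennreal (exp (h i * x i - (h i)\<^sup>2 / 2)))"
    proof (rule G.PiM_density[OF I])
      fix i show "sigma_finite_measure (density std_gaussian (\<lambda>x. ennreal (exp (h i * x - (h i)\<^sup>2 / 2))))"
        unfolding shifted_gaussian_density[symmetric]
        by (intro prob_space_imp_sigma_finite prob_space_normal_density) simp
    qed simp
    finally show ?thesis .
  qed
  have prodexp: "(\<Prod>i\<in>I. ennreal (exp (h i * x i - (h i)\<^sup>2 / 2))) = ennreal (exp ((\<Sum>i\<in>I. h i * x i) - \<sigma>\<^sup>2 / 2))" for x
    using I by (simp add: prod_ennreal exp_sum[symmetric] sum_subtractf s2 sum_divide_distrib)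
  define E where "E = {x \<in> space ?B. (\<Sum>i\<in>I. h i * x i) - \<sigma>\<^sup>2 / 2 \<le> \<epsilon>}"
  have E: "E \<in> sets ?B" unfolding E_def by measurable
  have m1: "prob {\<omega>\<in>space M. (\<lambda>i\<in>I. Z i \<omega>) \<in> B'} = measure ?\<mu> B'" if "B' \<in> sets ?B" for B'
    unfolding law1[symmetric] using that
    by (subst measure_distr[OF Z1m]) (auto intro!: arg_cong[where f=prob])
  have m2: "prob {\<omega>\<in>space M. (\<lambda>i\<in>I. Z i \<omega> + h i) \<in> B'}
    = measure (density ?\<mu> (\<lambda>x. ennreal (exp ((\<Sum>i\<in>I. h i * x i) - \<sigma>\<^sup>2 / 2)))) B'" if "B' \<in> sets ?B" for B'
    using that law2 unfolding prodexp
    by (simp add: law2[unfolded prodexp, symmetric] measure_distr[OF Z2m])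
       (auto intro!: arg_cong[where f=prob])
  have fin: "prob {\<omega>\<in>space M. (\<lambda>i\<in>I. Z i \<omega> + h i) \<in> B \<inter> E} \<le> exp \<epsilon> * prob {\<omega>\<in>space M. (\<lambda>i\<in>I. Z i \<omega>) \<in> B}"
  proof -
    let ?g = "\<lambda>x. ennreal (exp ((\<Sum>i\<in>I. h i * x i) - \<sigma>\<^sup>2 / 2))"
    have gm: "?g \<in> borel_measurable ?\<mu>"
      by (rule measurable_compose[OF _ measurable_ennreal]) measurable
    have "emeasure (density ?\<mu> ?g) (B \<inter> E) = (\<integral>\<^sup>+x. ?g x * indicator (B \<inter> E) x \<partial>?\<mu>)"
      using B E sets_\<mu> by (intro emeasure_density gm) auto
    also have "\<dots> \<le> (\<integral>\<^sup>+x. ennreal (exp \<epsilon>) * indicator B x \<partial>?\<mu>)"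
      by (intro nn_integral_mono) (auto simp: indicator_def E_def intro!: ennreal_leI)
    also have "\<dots> = ennreal (exp \<epsilon>) * emeasure ?\<mu> B"
      using B sets_\<mu> by (subst nn_integral_cmult_indicator) auto
    also have "\<dots> = ennreal (exp \<epsilon> * measure ?\<mu> B)"
      by (simp add: GP.emeasure_eq_measure ennreal_mult)
    finally have "measure (density ?\<mu> ?g) (B \<inter> E) \<le> exp \<epsilon> * measure ?\<mu> B"
      unfolding measure_def by (simp add: enn2real_leI)
    then show ?thesis using m1[OF B] m2[of "B \<inter> E"] B E by auto
  qed
  have tail: "prob {\<omega>\<in>space M. (\<lambda>i\<in>I. Z i \<omega> + h i) \<notin> E} \<le> Qfun (\<epsilon> / \<sigma> - \<sigma> / 2)"
  proof -
    let ?X = "\<lambda>\<omega>. (\<Sum>i\<in>I. h i * Z i \<omega>) / \<sigma>"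
    have X: "distributed M lborel ?X (\<lambda>x. ennreal (std_normal_density x))"
      unfolding \<sigma>(1) using \<sigma> s2 by (intro linear_form_std_normal I ind Z) auto
    have [measurable]: "?X \<in> borel_measurable M" using distributed_measurable[OF X] by simp
    have "{\<omega>\<in>space M. (\<lambda>i\<in>I. Z i \<omega> + h i) \<notin> E} \<subseteq> {\<omega>\<in>space M. \<epsilon> / \<sigma> - \<sigma> / 2 \<le> ?X \<omega>}"
    proof safe
      fix \<omega> assume w: "\<omega> \<in> space M" "(\<lambda>i\<in>I. Z i \<omega> + h i) \<notin> E"
      have "(\<lambda>i\<in>I. Z i \<omega> + h i) \<in> space ?B" by (auto simp: space_PiM)
      with w have "(\<Sum>i\<in>I. h i * (Z i \<omega> + h i)) - \<sigma>\<^sup>2 / 2 > \<epsilon>" by (auto simp: E_def)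
      moreover have "(\<Sum>i\<in>I. h i * (Z i \<omega> + h i)) = (\<Sum>i\<in>I. h i * Z i \<omega>) + \<sigma>\<^sup>2"
        unfolding s2 by (simp add: algebra_simps sum.distrib power2_eq_square)
      ultimately have "(\<Sum>i\<in>I. h i * Z i \<omega>) + \<sigma>\<^sup>2 / 2 > \<epsilon>" by simp
      then have "(\<epsilon> - \<sigma>\<^sup>2 / 2) / \<sigma> \<le> (\<Sum>i\<in>I. h i * Z i \<omega>) / \<sigma>" using \<sigma>(2) by (intro divide_right_mono) auto
      then show "\<epsilon> / \<sigma> - \<sigma> / 2 \<le> ?X \<omega>" using \<sigma>(2) by (simp add: field_simps power2_eq_square)
    qed
    then have "prob {\<omega>\<in>space M. (\<lambda>i\<in>I. Z i \<omega> + h i) \<notin> E} \<le> prob {\<omega>\<in>space M. \<epsilon> / \<sigma> - \<sigma> / 2 \<le> ?X \<omega>}"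
      by (intro finite_measure_mono) auto
    with prob_std_normal_ge[OF X] show ?thesis by simp
  qed
  have meas: "{\<omega>\<in>space M. (\<lambda>i\<in>I. Z i \<omega> + h i) \<in> B'} \<in> events" if "B' \<in> sets ?B" for B'
    using measurable_sets[OF Z2m that] by (simp add: vimage_def Int_def conj_commute)
  have mc: "{\<omega>\<in>space M. (\<lambda>i\<in>I. Z i \<omega> + h i) \<notin> E} \<in> events"
    using sets.compl_sets[OF meas[OF E]] by (rule back_subst[of "\<lambda>A. A \<in> events"]) auto
  have "prob {\<omega>\<in>space M. (\<lambda>i\<in>I. Z i \<omega> + h i) \<in> B}
    \<le> prob ({\<omega>\<in>space M. (\<lambda>i\<in>I. Z i \<omega> + h i) \<in> B \<inter> E} \<union> {\<omega>\<in>space M. (\<lambda>i\<in>I. Z i \<omega> + h i) \<notin> E})"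
    using meas[of "B \<inter> E"] mc B E by (intro finite_measure_mono) auto
  also have "\<dots> \<le> prob {\<omega>\<in>space M. (\<lambda>i\<in>I. Z i \<omega> + h i) \<in> B \<inter> E} + prob {\<omega>\<in>space M. (\<lambda>i\<in>I. Z i \<omega> + h i) \<notin> E}"
    using meas[of "B \<inter> E"] mc B E by (intro measure_subadditive) auto
  finally show ?thesis using fin tail by linarith
qed


section \<open>Extending an inequality between two measures from an algebra to the generated
  \<sigma>-algebra\<close>

text \<open>One set \<open>B\<close> has to approximate \<open>S\<close> in both measures at once,
  because the inequality to be transferred compares the two masses of the same \<open>B\<close>. In
  the induction a countable union is cut to finitely many members, each of which is replaced by its
  approximation.\<close>

lemma sigma_sets_approx_by_algebra:
  assumes "Sigma_Algebra.algebra \<Omega> \<A>"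
    and M: "finite_measure M" "sets M = sigma_sets \<Omega> \<A>" "space M = \<Omega>"
    and N: "finite_measure N" "sets N = sigma_sets \<Omega> \<A>" "space N = \<Omega>"
    and S: "S \<in> sigma_sets \<Omega> \<A>" and "e > 0"
  shows "\<exists>B\<in>\<A>. measure M ((S - B) \<union> (B - S)) < e \<and> measure N ((S - B) \<union> (B - S)) < e"
  using S \<open>e > 0\<close>
proof (induction S arbitrary: e rule: sigma_sets.induct)
  interpret A: Sigma_Algebra.algebra \<Omega> \<A> by fact
  interpret M: finite_measure M by fact
  interpret N: finite_measure N by fact
  {
    case (Basic a)
    then show ?case by (intro bexI[of _ a]) auto
  next
    case Empty
    then show ?case by (intro bexI[of _ "{}"]) auto
  next
    case (Compl a)
    from Compl.IH[OF Compl.prems] obtain B where B: "B \<in> \<A>"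
      "measure M ((a - B) \<union> (B - a)) < e" "measure N ((a - B) \<union> (B - a)) < e" by blast
    have "a \<subseteq> \<Omega>" using Compl.hyps M by (metis sets.sets_into_space)
    moreover have "B \<subseteq> \<Omega>" using B A.space_closed by auto
    ultimately have "(\<Omega> - a) - (\<Omega> - B) \<union> ((\<Omega> - B) - (\<Omega> - a)) = (a - B) \<union> (B - a)" by auto
    then show ?case using B by (intro bexI[of _ "\<Omega> - B"]) auto
  next
    case (Union a)
    note aM = Union.hyps[folded M(2)] and aN = Union.hyps[folded N(2)]
    \<comment> \<open>Continuity from above: what the finite unions miss decreases to the empty set,
      and the measure is finite.\<close>
    have tail: "\<exists>n0. \<forall>n\<ge>n0. measure K ((\<Union>i. a i) - (\<Union>i<n. a i)) < e / 2"
      if "finite_measure K" and aK: "\<And>i. a i \<in> sets K" for K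
    proof -
      interpret K: finite_measure K by fact
      have "(\<lambda>n. measure K ((\<Union>i. a i) - (\<Union>i<n. a i))) \<longlonglongrightarrow> measure K (\<Inter>n. (\<Union>i. a i) - (\<Union>i<n. a i))"
        using aK by (intro K.finite_Lim_measure_decseq)
          (auto simp: decseq_def intro!: sets.Diff sets.countable_UN sets.finite_UN)
      also have "(\<Inter>n. (\<Union>i. a i) - (\<Union>i<n. a i)) = {}" by auto
      finally have "(\<lambda>n. measure K ((\<Union>i. a i) - (\<Union>i<n. a i))) \<longlonglongrightarrow> 0" by simp
      then show ?thesis using Union.prems
        by (auto dest!: order_tendstoD(2)[where a="e/2"] simp: eventually_sequentially)
    qed
    obtain n1 where n1: "\<And>n. n \<ge> n1 \<Longrightarrow> measure M ((\<Union>i. a i) - (\<Union>i<n. a i)) < e / 2"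
      using tail[OF M(1)] aM by auto
    obtain n2 where n2: "\<And>n. n \<ge> n2 \<Longrightarrow> measure N ((\<Union>i. a i) - (\<Union>i<n. a i)) < e / 2"
      using tail[OF N(1)] aN by auto
    \<comment> \<open>The \<open>Suc\<close> keeps \<open>n\<close> positive, so that the tolerance
      e / (2 n) granted to each of the \<open>n\<close> members is positive; together these amount
      to e / 2, the tail taking the other half.\<close>
    define n where "n = Suc (max n1 n2)"
    have n: "n > 0" by (simp add: n_def)
    define e' where "e' = e / (2 * real n)"
    have "e' > 0" using Union.prems n by (simp add: e'_def)
    from Union.IH[OF this] have "\<forall>i. \<exists>B. B \<in> \<A> \<and> measure M ((a i - B) \<union> (B - a i)) < e' \<and>
      measure N ((a i - B) \<union> (B - a i)) < e'" by blast
    then obtain B where B: "\<And>i. B i \<in> \<A>" "\<And>i. measure M ((a i - B i) \<union> (B i - a i)) < e'"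
      "\<And>i. measure N ((a i - B i) \<union> (B i - a i)) < e'" by metis
    let ?B = "\<Union>i<n. B i"
    let ?d = "\<lambda>i. (a i - B i) \<union> (B i - a i)"
    have bound: "measure K ((\<Union>i. a i) - ?B \<union> (?B - (\<Union>i. a i))) < e"
      if "finite_measure K" and K: "sets K = sigma_sets \<Omega> \<A>" and "\<And>i. measure K (?d i) < e'"
        and t: "measure K ((\<Union>i. a i) - (\<Union>i<n. a i)) < e / 2" for K
    proof -
      interpret K: finite_measure K by fact
      have [measurable]: "a i \<in> sets K" "B i \<in> sets K" for i
        using Union.hyps B(1) K by auto
      have "measure K ((\<Union>i. a i) - ?B \<union> (?B - (\<Union>i. a i)))
         \<le> measure K (((\<Union>i. a i) - (\<Union>i<n. a i)) \<union> (\<Union>i<n. ?d i))"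
        by (intro K.finite_measure_mono) (auto intro!: sets.finite_UN sets.Un sets.Diff sets.countable_UN)
      also have "\<dots> \<le> measure K ((\<Union>i. a i) - (\<Union>i<n. a i)) + measure K (\<Union>i<n. ?d i)"
        by (intro measure_subadditive) (auto intro!: sets.finite_UN sets.Un sets.Diff sets.countable_UN)
      also have "measure K (\<Union>i<n. ?d i) \<le> (\<Sum>i<n. measure K (?d i))"
        by (intro K.finite_measure_subadditive_finite) auto
      also have "\<dots> \<le> (\<Sum>i<n. e')" using that(3) by (intro sum_mono) (simp add: less_imp_le)
      also have "\<dots> = e / 2" using n by (simp add: e'_def)
      finally show ?thesis using t by simp
    qed
    have "?B \<in> \<A>" using B by auto
    moreover have "n \<ge> n1" "n \<ge> n2" by (auto simp: n_def)
    ultimately show ?case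
      using bound[OF M(1,2) B(2) n1] bound[OF N(1,2) B(3) n2] by blast
  }
qed

lemma measure_le_on_sigma_sets:
  fixes a b :: real
  assumes "Sigma_Algebra.algebra \<Omega> \<A>"
    and M: "finite_measure M" "sets M = sigma_sets \<Omega> \<A>" "space M = \<Omega>"
    and N: "finite_measure N" "sets N = sigma_sets \<Omega> \<A>" "space N = \<Omega>"
    and le: "\<And>B. B \<in> \<A> \<Longrightarrow> measure M B \<le> a * measure N B + b"
    and "a \<ge> 0" and S: "S \<in> sigma_sets \<Omega> \<A>"
  shows "measure M S \<le> a * measure N S + b"
proof (rule field_le_epsilon)
  fix e :: real assume e: "e > 0"
  interpret M: finite_measure M by fact
  interpret N: finite_measure N by fact
  \<comment> \<open>Exchanging \<open>S\<close> and \<open>B\<close> costs e' for \<open>M\<close>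
    and a e' for the scaled \<open>N\<close>, altogether (1 + a) e'.\<close>
  define e' where "e' = e / (1 + a)"
  have "e' > 0" using e \<open>a \<ge> 0\<close> by (simp add: e'_def)
  from sigma_sets_approx_by_algebra[OF assms(1) M N S this] obtain B where B: "B \<in> \<A>"
    "measure M ((S - B) \<union> (B - S)) < e'" "measure N ((S - B) \<union> (B - S)) < e'" by blast
  have [measurable]: "B \<in> sets M" "S \<in> sets M" "B \<in> sets N" "S \<in> sets N"
    using B S M N by auto
  have "measure M S \<le> measure M (B \<union> ((S - B) \<union> (B - S)))"
    by (intro M.finite_measure_mono) auto
  also have "\<dots> \<le> measure M B + measure M ((S - B) \<union> (B - S))"
    by (intro measure_subadditive) auto
  finally have 1: "measure M S \<le> measure M B + e'" using B by simp
  have "measure N B \<le> measure N (S \<union> ((S - B) \<union> (B - S)))"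
    by (intro N.finite_measure_mono) auto
  also have "\<dots> \<le> measure N S + measure N ((S - B) \<union> (B - S))"
    by (intro measure_subadditive) auto
  finally have "measure N B \<le> measure N S + e'" using B by simp
  then have "a * measure N B \<le> a * (measure N S + e')" using \<open>a \<ge> 0\<close> by (intro mult_left_mono)
  with 1 le[OF B(1)] have "measure M S \<le> a * measure N S + b + (1 + a) * e'"
    by (simp add: algebra_simps)
  also have "(1 + a) * e' = e" using \<open>a \<ge> 0\<close> by (simp add: e'_def)
  finally show "measure M S \<le> a * measure N S + b + e" .
qed

section \<open>Cylinder sets of the signal space\<close>

text \<open>Times and components are flattened into one finite index set, the form in which the
  finite-dimensional shift bound is stated.\<close>

definition signal_coords :: "nat \<Rightarrow> nat \<Rightarrow> (nat \<Rightarrow> real vec) \<Rightarrow> nat \<times> nat \<Rightarrow> real" where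
  "signal_coords r T s = (\<lambda>(t, j)\<in>{..<T} \<times> {..<r}. s t $ j)"

text \<open>Windows are initial time segments with all components instead of arbitrary finite sets
  of coordinates. They are nested, which makes intersections easy, and every coordinate lies in one
  of them.\<close>

definition signal_cylinders :: "nat \<Rightarrow> (nat \<Rightarrow> real vec) set set" where
  "signal_cylinders r = {signal_coords r T -` B \<inter> space (signal_space r) | T B.
     B \<in> sets (PiM ({..<T} \<times> {..<r}) (\<lambda>_. borel))}"

lemma space_borel_vec [simp]: "space (borel_vec r) = carrier_vec r"
  by (simp add: borel_vec_def)

lemma space_signal_space: "space (signal_space r) = {s. \<forall>t. s t \<in> carrier_vec r}"
  by (auto simp: signal_space_def space_PiM PiE_def)

lemma measurable_vec_nth_borel_vec: "j < r \<Longrightarrow> (\<lambda>v. v $ j) \<in> borel_measurable (borel_vec r)"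
proof -
  assume j: "j < r"
  have "(\<lambda>v. \<lambda>j\<in>{..<r}. v $ j) \<in> measurable (borel_vec r) (\<Pi>\<^sub>M j\<in>{..<r}. borel)"
    unfolding borel_vec_def by (rule measurable_vimage_algebra1) (auto simp: space_PiM)
  from measurable_compose[OF this measurable_component_singleton[of j]] j
  show ?thesis by simp
qed

lemma measurable_signal_coord: "j < r \<Longrightarrow> (\<lambda>s. s t $ j) \<in> borel_measurable (signal_space r)"
  unfolding signal_space_def
  by (rule measurable_compose[where g="\<lambda>v. v $ j", OF measurable_component_singleton[of t] measurable_vec_nth_borel_vec]) auto

lemma measurable_signal_coords:
  "signal_coords r T \<in> measurable (signal_space r) (PiM ({..<T} \<times> {..<r}) (\<lambda>_. borel))"
  unfolding signal_coords_def
  by (rule measurable_restrict) (auto intro: measurable_signal_coord)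

lemma measurable_into_signal_space:
  assumes "\<And>\<omega> t. \<omega> \<in> space M \<Longrightarrow> F \<omega> t \<in> carrier_vec r"
    and "\<And>t j. j < r \<Longrightarrow> (\<lambda>\<omega>. F \<omega> t $ j) \<in> borel_measurable M"
  shows "F \<in> measurable M (signal_space r)"
proof -
  have "(\<lambda>\<omega>. F \<omega> t) \<in> measurable M (borel_vec r)" for t
    unfolding borel_vec_def
    by (rule measurable_vimage_algebra2) (use assms in \<open>auto intro!: measurable_restrict\<close>)
  then show ?thesis unfolding signal_space_def
    by (intro measurable_PiM_single') (auto simp: space_PiM assms)
qed

lemma algebra_signal_cylinders: "Sigma_Algebra.algebra (space (signal_space r)) (signal_cylinders r)"
proof -
  let ?\<Omega> = "space (signal_space r)"
  let ?B = "\<lambda>T. PiM ({..<T} \<times> {..<r}) (\<lambda>_. borel :: real measure)"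
  \<comment> \<open>A cylinder over the window \<open>T\<close> is also one over any longer window,
    by the preimage under restriction; two cylinders can thus be intersected over
    \<open>max T T'\<close>.\<close>
  have lift: "\<exists>B'\<in>sets (?B T'). signal_coords r T -` B \<inter> ?\<Omega> = signal_coords r T' -` B' \<inter> ?\<Omega>"
    if "T \<le> T'" and B: "B \<in> sets (?B T)" for T T' B
  proof
    let ?f = "\<lambda>x. restrict x ({..<T} \<times> {..<r})"
    have f: "?f \<in> measurable (?B T') (?B T)"
      using that(1) by (intro measurable_restrict_subset) auto
    show "?f -` B \<inter> space (?B T') \<in> sets (?B T')" by (rule measurable_sets[OF f B])
    have "?f (signal_coords r T' s) = signal_coords r T s" for s
      using that(1) by (auto simp: signal_coords_def restrict_def fun_eq_iff)
    moreover have "signal_coords r T' s \<in> space (?B T')" for s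
      by (auto simp: signal_coords_def space_PiM)
    ultimately show "signal_coords r T -` B \<inter> ?\<Omega> = signal_coords r T' -` (?f -` B \<inter> space (?B T')) \<inter> ?\<Omega>"
      by auto
  qed
  show ?thesis
    unfolding algebra_iff_Int
  proof (intro conjI ballI)
    show "signal_cylinders r \<subseteq> Pow ?\<Omega>" by (auto simp: signal_cylinders_def)
    show "{} \<in> signal_cylinders r" unfolding signal_cylinders_def by blast
    fix a assume "a \<in> signal_cylinders r"
    then obtain T B where a: "a = signal_coords r T -` B \<inter> ?\<Omega>" "B \<in> sets (?B T)"
      by (auto simp: signal_cylinders_def)
    have "?\<Omega> - a = signal_coords r T -` (space (?B T) - B) \<inter> ?\<Omega>"
      using measurable_space[OF measurable_signal_coords] by (auto simp: a)
    moreover have "space (?B T) - B \<in> sets (?B T)" using a by auto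
    ultimately show "?\<Omega> - a \<in> signal_cylinders r" unfolding signal_cylinders_def by blast
    fix b assume "b \<in> signal_cylinders r"
    then obtain T' B' where b: "b = signal_coords r T' -` B' \<inter> ?\<Omega>" "B' \<in> sets (?B T')"
      by (auto simp: signal_cylinders_def)
    obtain C where C: "C \<in> sets (?B (max T T'))" "a = signal_coords r (max T T') -` C \<inter> ?\<Omega>"
      using lift[of T "max T T'" B] a by auto
    obtain C' where C': "C' \<in> sets (?B (max T T'))" "b = signal_coords r (max T T') -` C' \<inter> ?\<Omega>"
      using lift[of T' "max T T'" B'] b by auto
    have "a \<inter> b = signal_coords r (max T T') -` (C \<inter> C') \<inter> ?\<Omega>" using C C' by auto
    moreover have "C \<inter> C' \<in> sets (?B (max T T'))" using C C' by auto
    ultimately show "a \<inter> b \<in> signal_cylinders r" unfolding signal_cylinders_def by blast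
  qed
qed

lemma sets_signal_space: "sets (signal_space r) = sigma_sets (space (signal_space r)) (signal_cylinders r)"
proof
  let ?\<Omega> = "space (signal_space r)"
  show "sigma_sets ?\<Omega> (signal_cylinders r) \<subseteq> sets (signal_space r)"
    by (rule sets.sigma_sets_subset) (auto simp: signal_cylinders_def intro: measurable_sets[OF measurable_signal_coords])
  let ?N = "sigma ?\<Omega> (signal_cylinders r)"
  have sub: "signal_cylinders r \<subseteq> Pow ?\<Omega>" by (auto simp: signal_cylinders_def)
  \<comment> \<open>Measurability of the identity from the generated \<sigma>-algebra says that all
    sets of \<open>signal_space r\<close> lie in it, and it can be checked on single
    coordinates.\<close>
  have "(\<lambda>s. s) \<in> measurable ?N (signal_space r)"
  proof (rule measurable_into_signal_space)
    fix \<omega> t assume "\<omega> \<in> space ?N" then show "\<omega> t \<in> carrier_vec r"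
      using sub by (simp add: space_measure_of space_signal_space)
  next
    fix t j assume j: "j < r"
    show "(\<lambda>\<omega>. \<omega> t $ j) \<in> borel_measurable ?N"
    proof (rule measurableI)
      fix A :: "real set" assume A: "A \<in> sets borel"
      let ?B = "PiM ({..<Suc t} \<times> {..<r}) (\<lambda>_. borel :: real measure)"
      have m: "(\<lambda>x. x (t, j)) \<in> measurable ?B borel"
        using j by (intro measurable_component_singleton) auto
      have "(\<lambda>\<omega>. \<omega> t $ j) -` A \<inter> ?\<Omega> = signal_coords r (Suc t) -` ((\<lambda>x. x (t, j)) -` A \<inter> space ?B) \<inter> ?\<Omega>"
        using j by (auto simp: signal_coords_def space_PiM)
      then have "(\<lambda>\<omega>. \<omega> t $ j) -` A \<inter> ?\<Omega> \<in> signal_cylinders r"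
        unfolding signal_cylinders_def using measurable_sets[OF m A] by blast
      then show "(\<lambda>\<omega>. \<omega> t $ j) -` A \<inter> space ?N \<in> sets ?N"
        using sub by (simp add: space_measure_of)
    qed simp
  qed
  from measurable_sets[OF this] show "sets (signal_space r) \<subseteq> sigma_sets ?\<Omega> (signal_cylinders r)"
    using sub sets.sets_into_space[of _ "signal_space r"] by (auto simp: space_measure_of Int_absorb2)
qed

text \<open>Seen through a window, the release from \<open>m\<close> is the image of the noise
  shifted by (m - m') / c, and the release from \<open>m'\<close> is the image of the unshifted
  noise under the same affine map. The shift has length at most \<Delta> / c, hence at most 1 /
  \<open>kappa \<delta> \<epsilon>\<close>. The sensitivity is assumed window by window because a
  cylinder sees only one window.\<close>

lemma gaussian_mechanism_signal_space:
  assumes "prob_space P" and noise: "standard_white_noise P r \<nu>"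
    and eps: "\<epsilon> > 0" "0 < \<delta>" "\<delta> < 1"
    and c: "c > 0" "\<Delta> * kappa \<delta> \<epsilon> \<le> c"
    and m: "\<And>t. m t \<in> carrier_vec r" and m': "\<And>t. m' t \<in> carrier_vec r"
    and sens: "\<And>T. (\<Sum>t<T. \<Sum>j<r. (m t $ j - m' t $ j)\<^sup>2) \<le> \<Delta>\<^sup>2" "\<Delta> \<ge> 0"
    and S: "S \<in> sets (signal_space r)"
  shows "measure P {\<omega>\<in>space P. (\<lambda>t. m t + c \<cdot>\<^sub>v \<nu> \<omega> t) \<in> S}
    \<le> exp \<epsilon> * measure P {\<omega>\<in>space P. (\<lambda>t. m' t + c \<cdot>\<^sub>v \<nu> \<omega> t) \<in> S} + \<delta>"
proof -
  interpret P: prob_space P by fact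
  have \<nu>m: "\<nu> \<in> measurable P (signal_space r)"
    and \<nu>d: "\<And>t j. j < r \<Longrightarrow> distributed P lborel (\<lambda>\<omega>. \<nu> \<omega> t $ j) (\<lambda>z. ennreal (std_normal_density z))"
    and \<nu>i: "P.indep_vars (\<lambda>_. borel) (\<lambda>(t, j) \<omega>. \<nu> \<omega> t $ j) (UNIV \<times> {..<r})"
    using noise by (auto simp: standard_white_noise_def)
  have \<nu>c: "\<nu> \<omega> t \<in> carrier_vec r" if "\<omega> \<in> space P" for \<omega> t
    using measurable_space[OF \<nu>m that] by (auto simp: space_signal_space)
  let ?F = "\<lambda>m \<omega> t. m t + c \<cdot>\<^sub>v \<nu> \<omega> t"
  have coord: "?F k \<omega> t $ j = k t $ j + c * \<nu> \<omega> t $ j"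
    if "\<omega> \<in> space P" "j < r" for k \<omega> t j
    using \<nu>c[OF that(1), of t] that(2) by auto
  have Fm: "?F k \<in> measurable P (signal_space r)" if k: "\<And>t. k t \<in> carrier_vec r" for k
  proof (rule measurable_into_signal_space)
    show "?F k \<omega> t \<in> carrier_vec r" if "\<omega> \<in> space P" for \<omega> t using k \<nu>c[OF that] by auto
    fix t j assume j: "j < r"
    have [measurable]: "(\<lambda>\<omega>. \<nu> \<omega> t $ j) \<in> borel_measurable P"
      using measurable_compose[OF \<nu>m measurable_signal_coord[OF j]] .
    have "(\<lambda>\<omega>. k t $ j + c * \<nu> \<omega> t $ j) \<in> borel_measurable P" by measurable
    then show "(\<lambda>\<omega>. ?F k \<omega> t $ j) \<in> borel_measurable P"
      by (rule measurable_cong[THEN iffD1, rotated]) (use coord j in auto)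
  qed
  have distr: "measure (distr P (signal_space r) (?F k)) B = P.prob {\<omega>\<in>space P. ?F k \<omega> \<in> B}"
    if "\<And>t. k t \<in> carrier_vec r" "B \<in> sets (signal_space r)" for k B
    using that by (subst measure_distr[OF Fm]) (auto intro!: arg_cong[where f=P.prob])
  have fin: "finite_measure (distr P (signal_space r) (?F k))" if "\<And>t. k t \<in> carrier_vec r" for k
    by (intro P.finite_measure_distr Fm that)
  have "measure (distr P (signal_space r) (?F m)) S \<le> exp \<epsilon> * measure (distr P (signal_space r) (?F m')) S + \<delta>"
  proof (rule measure_le_on_sigma_sets[OF algebra_signal_cylinders fin[OF m] _ _ fin[OF m']])
    fix A assume A: "A \<in> signal_cylinders r"
    then obtain T B where AB: "A = signal_coords r T -` B \<inter> space (signal_space r)"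
      and B: "B \<in> sets (PiM ({..<T} \<times> {..<r}) (\<lambda>_. borel))" by (auto simp: signal_cylinders_def)
    let ?I = "{..<T} \<times> {..<r}"
    let ?PB = "PiM ?I (\<lambda>_. borel :: real measure)"
    let ?Z = "\<lambda>(t, j) \<omega>. \<nu> \<omega> t $ j"
    define h where "h = (\<lambda>(t, j). (m t $ j - m' t $ j) / c)"
    \<comment> \<open>\<open>u\<close> carries the noise to the release with mean \<open>m'\<close>;
      as c times \<open>h\<close> is m - m', it carries the noise shifted by \<open>h\<close> to the
      release with mean \<open>m\<close>. \<open>B'\<close> is the event pulled back to the
      noise.\<close>
    define u where "u x = (\<lambda>i\<in>?I. c * x i + (case i of (t, j) \<Rightarrow> m' t $ j))" for x
    define B' where "B' = u -` B \<inter> space ?PB"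
    have "u \<in> measurable ?PB ?PB" unfolding u_def by measurable
    then have B': "B' \<in> sets ?PB" unfolding B'_def by (rule measurable_sets) (rule B)
    have inA: "?F k \<omega> \<in> A \<longleftrightarrow> signal_coords r T (?F k \<omega>) \<in> B"
      if "\<And>t. k t \<in> carrier_vec r" "\<omega> \<in> space P" for k \<omega>
      using measurable_space[OF Fm[OF that(1)] that(2)] by (auto simp: AB)
    have e1: "{\<omega>\<in>space P. ?F m \<omega> \<in> A} = {\<omega>\<in>space P. (\<lambda>i\<in>?I. ?Z i \<omega> + h i) \<in> B'}"
    proof (rule Collect_cong, rule conj_cong[OF refl])
      fix \<omega> assume w: "\<omega> \<in> space P"
      have "signal_coords r T (?F m \<omega>) = u (\<lambda>i\<in>?I. ?Z i \<omega> + h i)"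
        unfolding signal_coords_def u_def using c(1)
        by (intro restrict_ext) (auto simp: coord[OF w] h_def field_simps simp del: index_add_vec index_smult_vec)
      then show "?F m \<omega> \<in> A \<longleftrightarrow> (\<lambda>i\<in>?I. ?Z i \<omega> + h i) \<in> B'"
        unfolding inA[OF m w] B'_def by (auto simp: space_PiM)
    qed
    have e2: "{\<omega>\<in>space P. ?F m' \<omega> \<in> A} = {\<omega>\<in>space P. (\<lambda>i\<in>?I. ?Z i \<omega>) \<in> B'}"
    proof (rule Collect_cong, rule conj_cong[OF refl])
      fix \<omega> assume w: "\<omega> \<in> space P"
      have "signal_coords r T (?F m' \<omega>) = u (\<lambda>i\<in>?I. ?Z i \<omega>)"
        unfolding signal_coords_def u_def
        by (intro restrict_ext) (auto simp: coord[OF w] simp del: index_add_vec index_smult_vec)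
      then show "?F m' \<omega> \<in> A \<longleftrightarrow> (\<lambda>i\<in>?I. ?Z i \<omega>) \<in> B'"
        unfolding inA[OF m' w] B'_def by (auto simp: space_PiM)
    qed
    have main: "P.prob {\<omega>\<in>space P. (\<lambda>i\<in>?I. ?Z i \<omega> + h i) \<in> B'}
       \<le> exp \<epsilon> * P.prob {\<omega>\<in>space P. (\<lambda>i\<in>?I. ?Z i \<omega>) \<in> B'} + \<delta>"
    \<comment> \<open>A zero shift on this window leaves the law unchanged; only a nonzero one
      allows a division by \<sigma>.\<close>
    proof (cases "(\<Sum>i\<in>?I. (h i)\<^sup>2) = 0")
      case True
      then have "h i = 0" if "i \<in> ?I" for i
        using that by (subst (asm) sum_nonneg_eq_0_iff) auto
      then have "(\<lambda>i\<in>?I. ?Z i \<omega> + h i) = (\<lambda>i\<in>?I. ?Z i \<omega>)" for \<omega>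
        by (intro restrict_ext) simp
      then have "P.prob {\<omega>\<in>space P. (\<lambda>i\<in>?I. ?Z i \<omega> + h i) \<in> B'} = 1 * P.prob {\<omega>\<in>space P. (\<lambda>i\<in>?I. ?Z i \<omega>) \<in> B'}"
        by simp
      also have "\<dots> \<le> exp \<epsilon> * P.prob {\<omega>\<in>space P. (\<lambda>i\<in>?I. ?Z i \<omega>) \<in> B'}"
        using eps by (intro mult_right_mono) auto
      finally show ?thesis using eps by simp
    next
      case False
      define \<sigma> where "\<sigma> = sqrt (\<Sum>i\<in>?I. (h i)\<^sup>2)"
      have \<sigma>: "\<sigma> > 0" using False by (simp add: \<sigma>_def sum_nonneg less_le)
      have "(c * \<sigma>)\<^sup>2 = c\<^sup>2 * (\<Sum>i\<in>?I. (h i)\<^sup>2)"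
        by (simp add: \<sigma>_def power_mult_distrib sum_nonneg)
      also have "\<dots> = (\<Sum>t<T. \<Sum>j<r. (m t $ j - m' t $ j)\<^sup>2)"
        using c(1) by (simp add: h_def sum_distrib_left sum.cartesian_product power_divide split_def)
      also have "\<dots> \<le> \<Delta>\<^sup>2" by (rule sens)
      finally have "c * \<sigma> \<le> \<Delta>" using sens(2) by (rule power2_le_imp_le)
      then have "c * \<sigma> * kappa \<delta> \<epsilon> \<le> \<Delta> * kappa \<delta> \<epsilon>"
        using kappa_pos[OF eps(1), of \<delta>] by (intro mult_right_mono) auto
      then have "c * (\<sigma> * kappa \<delta> \<epsilon>) \<le> c * 1" using c(2) by simp
      then have "\<sigma> * kappa \<delta> \<epsilon> \<le> 1" using c(1) by simp
      then have Q: "Qfun (\<epsilon> / \<sigma> - \<sigma> / 2) \<le> \<delta>" using \<sigma> eps by (intro Qfun_kappa_le)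
      have "P.prob {\<omega>\<in>space P. (\<lambda>i\<in>?I. ?Z i \<omega> + h i) \<in> B'}
         \<le> exp \<epsilon> * P.prob {\<omega>\<in>space P. (\<lambda>i\<in>?I. ?Z i \<omega>) \<in> B'} + Qfun (\<epsilon> / \<sigma> - \<sigma> / 2)"
      proof (rule P.gaussian_shift_privacy[OF _ _ _ \<sigma>_def \<sigma> B'])
        show "P.indep_vars (\<lambda>_. borel) ?Z ?I" by (rule P.indep_vars_subset[OF \<nu>i]) auto
        show "distributed P lborel (?Z i) (\<lambda>x. ennreal (std_normal_density x))" if "i \<in> ?I" for i
          using that \<nu>d by auto
      qed simp
      with Q show ?thesis by simp
    qed
    have "A \<in> sets (signal_space r)" using A by (auto simp: sets_signal_space)
    then show "measure (distr P (signal_space r) (?F m)) A \<le> exp \<epsilon> * measure (distr P (signal_space r) (?F m')) A + \<delta>"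
      using main unfolding e1[symmetric] e2[symmetric] by (simp add: distr m m')
  qed (use S in \<open>simp_all add: sets_signal_space\<close>)
  then show ?thesis by (simp add: distr m m' S)
qed

subsection \<open>Largest singular value\<close>

definition vec_sqnorm :: "complex vec \<Rightarrow> real" where
  "vec_sqnorm v = (\<Sum>k<dim_vec v. (cmod (v $ k))\<^sup>2)"

lemma vec_sqnorm_nonneg: "vec_sqnorm v \<ge> 0"
  by (simp add: vec_sqnorm_def sum_nonneg)

lemma vec_sqnorm_eq_0_iff: "v \<in> carrier_vec m \<Longrightarrow> vec_sqnorm v = 0 \<longleftrightarrow> v = 0\<^sub>v m"
  unfolding vec_sqnorm_def by (subst sum_nonneg_eq_0_iff) (auto intro!: eq_vecI)

lemma vec_sqnorm_smult: "vec_sqnorm (a \<cdot>\<^sub>v v) = (cmod a)\<^sup>2 * vec_sqnorm v"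
  by (simp add: vec_sqnorm_def norm_mult power_mult_distrib sum_distrib_left)

lemma cscalar_prod_self: "v \<bullet>c v = complex_of_real (vec_sqnorm v)"
  unfolding vec_sqnorm_def of_real_sum complex_norm_square
  by (simp add: scalar_prod_def atLeast0LessThan)

text \<open>Serves to expand the quadratic form l |x|^2 - |G x|^2 at a vector c v - w with real
  c.\<close>

lemma vec_sqnorm_scaled_diff:
  assumes "v \<in> carrier_vec m" "w \<in> carrier_vec m"
  shows "vec_sqnorm (complex_of_real s \<cdot>\<^sub>v v - w) = s\<^sup>2 * vec_sqnorm v - 2 * s * Re (v \<bullet>c w) + vec_sqnorm w"
proof -
  have e: "(cmod (complex_of_real s * a - b))\<^sup>2 = s\<^sup>2 * (cmod a)\<^sup>2 - 2 * s * Re (a * cnj b) + (cmod b)\<^sup>2" for a b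
    unfolding cmod_power2 by (simp add: power2_eq_square algebra_simps)
  show ?thesis using assms
    by (simp add: vec_sqnorm_def scalar_prod_def atLeast0LessThan e sum.distrib sum_subtractf
        sum_distrib_left distrib_left)
qed

lemma Re_cscalar_prod_le:
  assumes "v \<in> carrier_vec m" "w \<in> carrier_vec m"
  shows "Re (v \<bullet>c w) \<le> sqrt (vec_sqnorm v) * sqrt (vec_sqnorm w)"
proof -
  have "Re (v \<bullet>c w) = (\<Sum>k<m. Re (v $ k * cnj (w $ k)))"
    using assms by (simp add: scalar_prod_def atLeast0LessThan)
  also have "\<dots> \<le> (\<Sum>k<m. cmod (v $ k) * cmod (w $ k))"
    by (intro sum_mono order_trans[OF complex_Re_le_cmod]) (simp add: norm_mult)
  also have "\<dots> \<le> sqrt (vec_sqnorm v * vec_sqnorm w)"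
    using Cauchy_Schwarz_ineq_sum[of "\<lambda>k. cmod (v $ k)" "\<lambda>k. cmod (w $ k)" "{..<m}"] assms
    by (intro real_le_rsqrt) (simp add: vec_sqnorm_def)
  finally show ?thesis by (simp add: real_sqrt_mult)
qed

text \<open>The squared Frobenius norm, a crude bound for the squared operator norm where any finite
  bound is enough.\<close>

definition mat_sqnorm :: "complex mat \<Rightarrow> real" where
  "mat_sqnorm G = (\<Sum>j<dim_row G. \<Sum>k<dim_col G. (cmod (G $$ (j, k)))\<^sup>2)"

lemma vec_sqnorm_mult_mat_vec_le:
  assumes "G \<in> carrier_mat r m" "v \<in> carrier_vec m"
  shows "vec_sqnorm (G *\<^sub>v v) \<le> mat_sqnorm G * vec_sqnorm v"
proof -
  have "(cmod ((G *\<^sub>v v) $ j))\<^sup>2 \<le> (\<Sum>k<m. (cmod (G $$ (j, k)))\<^sup>2) * vec_sqnorm v" if j: "j < r" for j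
  proof -
    have "cmod ((G *\<^sub>v v) $ j) \<le> (\<Sum>k<m. cmod (G $$ (j, k)) * cmod (v $ k))"
      using assms j by (auto simp: scalar_prod_def atLeast0LessThan norm_mult intro!: sum_norm_le)
    then have "(cmod ((G *\<^sub>v v) $ j))\<^sup>2 \<le> (\<Sum>k<m. cmod (G $$ (j, k)) * cmod (v $ k))\<^sup>2"
      by (intro power_mono) auto
    also have "\<dots> \<le> (\<Sum>k<m. (cmod (G $$ (j, k)))\<^sup>2) * (\<Sum>k<m. (cmod (v $ k))\<^sup>2)"
      by (rule Cauchy_Schwarz_ineq_sum)
    finally show ?thesis using assms by (simp add: vec_sqnorm_def)
  qed
  then have "(\<Sum>j<r. (cmod ((G *\<^sub>v v) $ j))\<^sup>2) \<le> (\<Sum>j<r. (\<Sum>k<m. (cmod (G $$ (j, k)))\<^sup>2) * vec_sqnorm v)"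
    by (intro sum_mono) auto
  then show ?thesis using assms by (simp add: vec_sqnorm_def[of "G *\<^sub>v v"] mat_sqnorm_def sum_distrib_right)
qed

lemma mat_adjoint_carrier: "G \<in> carrier_mat r m \<Longrightarrow> mat_adjoint G \<in> carrier_mat m r"
  by (auto simp: mat_adjoint_def)

lemma mat_adjoint_index:
  "G \<in> carrier_mat r m \<Longrightarrow> k < m \<Longrightarrow> j < r \<Longrightarrow> mat_adjoint G $$ (k, j) = cnj (G $$ (j, k))"
  by (auto simp: mat_adjoint_def mat_of_rows_def)

lemma cscalar_prod_mat_adjoint:
  fixes G :: "complex mat"
  assumes G: "G \<in> carrier_mat r m" and v: "v \<in> carrier_vec m" and u: "u \<in> carrier_vec r"
  shows "(G *\<^sub>v v) \<bullet>c u = v \<bullet>c (mat_adjoint G *\<^sub>v u)"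
proof -
  have "(G *\<^sub>v v) \<bullet>c u = (\<Sum>j<r. (\<Sum>k<m. G $$ (j, k) * v $ k) * cnj (u $ j))"
    using assms by (auto simp: scalar_prod_def atLeast0LessThan)
  also have "\<dots> = (\<Sum>k<m. \<Sum>j<r. G $$ (j, k) * v $ k * cnj (u $ j))"
    by (subst sum.swap) (simp add: sum_distrib_right)
  also have "\<dots> = (\<Sum>k<m. v $ k * cnj (\<Sum>j<r. mat_adjoint G $$ (k, j) * u $ j))"
    using G by (auto simp: mat_adjoint_index sum_distrib_left mult_ac intro!: sum.cong)
  also have "\<dots> = v \<bullet>c (mat_adjoint G *\<^sub>v u)"
    using assms mat_adjoint_carrier[OF G] by (auto simp: scalar_prod_def atLeast0LessThan)
  finally show ?thesis .
qed

text \<open>Pairing the eigenvector equation with \<open>v\<close> and moving the adjoint across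
  shows that the eigenvalue is the Rayleigh quotient of \<open>v\<close>; a singular value is thus
  an attained stretching factor.\<close>

lemma gram_eigenvector_sqnorm:
  assumes G: "G \<in> carrier_mat r m" and "eigenvector (mat_adjoint G * G) v (complex_of_real a)"
  shows "v \<in> carrier_vec m" "v \<noteq> 0\<^sub>v m" "vec_sqnorm (G *\<^sub>v v) = a * vec_sqnorm v"
proof -
  note Ga = mat_adjoint_carrier[OF G]
  show v: "v \<in> carrier_vec m" and "v \<noteq> 0\<^sub>v m"
    using assms(2) G Ga by (auto simp: eigenvector_def)
  have "mat_adjoint G *\<^sub>v (G *\<^sub>v v) = complex_of_real a \<cdot>\<^sub>v v"
    using assms(2) G Ga v by (auto simp: eigenvector_def assoc_mult_mat_vec[OF Ga G v])
  then have "(G *\<^sub>v v) \<bullet>c (G *\<^sub>v v) = v \<bullet>c (complex_of_real a \<cdot>\<^sub>v v)"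
    using cscalar_prod_mat_adjoint[OF G v, of "G *\<^sub>v v"] G v by simp
  also have "\<dots> = complex_of_real a * (v \<bullet>c v)"
    using v by (simp add: scalar_prod_def sum_distrib_left mult_ac)
  finally have "complex_of_real (vec_sqnorm (G *\<^sub>v v)) = complex_of_real (a * vec_sqnorm v)"
    by (simp add: cscalar_prod_self)
  then show "vec_sqnorm (G *\<^sub>v v) = a * vec_sqnorm v" by (simp only: of_real_eq_iff)
qed

text \<open>If \<open>l\<close>, the supremum of the Rayleigh quotient, were not an eigenvalue of $G^*G$, then
  $l I - G^*G$ would be positive semidefinite and invertible, hence bounded below by a positive
  multiple of the identity, and \<open>l\<close> would not be the least upper bound.\<close>

lemma gram_max_eigenvalue:
  assumes G: "G \<in> carrier_mat r m" and m: "m > 0"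
  obtains l where "l \<ge> 0" "eigenvalue (mat_adjoint G * G) (complex_of_real l)"
    "\<And>v. v \<in> carrier_vec m \<Longrightarrow> vec_sqnorm (G *\<^sub>v v) \<le> l * vec_sqnorm v"
proof -
  let ?H = "mat_adjoint G * G"
  note Ga = mat_adjoint_carrier[OF G]
  have H: "?H \<in> carrier_mat m m" using Ga G by simp
  define R where "R = {vec_sqnorm (G *\<^sub>v v) | v. v \<in> carrier_vec m \<and> vec_sqnorm v = 1}"
  have bdd: "bdd_above R"
    unfolding R_def by (rule bdd_aboveI[of _ "mat_sqnorm G"]) (use vec_sqnorm_mult_mat_vec_le[OF G] in force)
  have "vec_sqnorm (unit_vec m 0) = 1"
    unfolding vec_sqnorm_def using m by (subst sum.remove[of _ 0]) auto
  then have ne: "R \<noteq> {}" unfolding R_def using unit_vec_carrier by blast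
  define l where "l = Sup R"
  have le1: "vec_sqnorm (G *\<^sub>v v) \<le> l" if "v \<in> carrier_vec m" "vec_sqnorm v = 1" for v
    unfolding l_def by (rule cSup_upper[OF _ bdd]) (use that in \<open>auto simp: R_def\<close>)
  have l0: "l \<ge> 0"
    using ne le1 vec_sqnorm_nonneg order_trans unfolding R_def by blast
  have le: "vec_sqnorm (G *\<^sub>v v) \<le> l * vec_sqnorm v" if v: "v \<in> carrier_vec m" for v
  proof (cases "vec_sqnorm v = 0")
    case True
    then show ?thesis using vec_sqnorm_mult_mat_vec_le[OF G v] by simp
  next
    case False
    define a where "a = vec_sqnorm v"
    have a: "a > 0" using False vec_sqnorm_nonneg[of v] by (simp add: a_def)
    define b where "b = complex_of_real (1 / sqrt a)"
    have b: "(cmod b)\<^sup>2 = 1 / a" using a by (simp add: b_def power_divide norm_divide)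
    have "vec_sqnorm (G *\<^sub>v (b \<cdot>\<^sub>v v)) \<le> l"
      using v a by (intro le1) (auto simp: vec_sqnorm_smult b a_def[symmetric])
    also have "G *\<^sub>v (b \<cdot>\<^sub>v v) = b \<cdot>\<^sub>v (G *\<^sub>v v)" by (rule mult_mat_vec[OF G v])
    finally show ?thesis using a by (simp add: vec_sqnorm_smult b a_def[symmetric] field_simps)
  qed
  have "eigenvalue ?H (complex_of_real l)"
  proof (rule ccontr)
    assume "\<not> eigenvalue ?H (complex_of_real l)"
    then have "det (char_matrix ?H (complex_of_real l)) \<noteq> 0" using eigenvalue_det[OF H] by simp
    moreover have cm: "char_matrix ?H (complex_of_real l) \<in> carrier_mat m m"
      using H by (rule char_matrix_closed)
    ultimately obtain N where N: "N \<in> carrier_mat m m" "char_matrix ?H (complex_of_real l) * N = 1\<^sub>m m"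
      using det_non_zero_imp_unit[OF cm] by (auto simp: Units_def ring_mat_def)
    \<comment> \<open>Dominates the operator norm of the inverse \<open>N\<close>; the added 1 makes
      positivity immediate.\<close>
    define c where "c = sqrt (mat_sqnorm N) + 1"
    have "mat_sqnorm N \<ge> 0" by (simp add: mat_sqnorm_def sum_nonneg)
    then have c: "c > 0" by (simp add: c_def add_nonneg_pos)
    \<comment> \<open>With H the Gram matrix, \<open>w\<close> solves (l - H) w = v, so the
      polarised form of q(x) = l |x|^2 - |G x|^2 at v and w is <v, v>. Nonnegativity of q at c v - w
      then reads 2 c |v|^2 \<le> c^2 q(v) + Re <w, v>, and the last term is at most |w| |v| \<le> c
      |v|^2.\<close>
    have gap: "vec_sqnorm v \<le> c * (l * vec_sqnorm v - vec_sqnorm (G *\<^sub>v v))" if v: "v \<in> carrier_vec m" for v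
    proof -
      define w where "w = (-1) \<cdot>\<^sub>v (N *\<^sub>v v)"
      have w: "w \<in> carrier_vec m" using N v by (simp add: w_def)
      have "char_matrix ?H (complex_of_real l) *\<^sub>v (N *\<^sub>v v) = v"
        using N v cm by (metis assoc_mult_mat_vec one_mult_mat_vec)
      then have "char_matrix ?H (complex_of_real l) *\<^sub>v w = (-1) \<cdot>\<^sub>v v"
        unfolding w_def using N v cm by (subst mult_mat_vec[of _ m m]) auto
      moreover have "char_matrix ?H (complex_of_real l) *\<^sub>v w = ?H *\<^sub>v w - complex_of_real l \<cdot>\<^sub>v w"
        unfolding char_matrix_def using H w
        by (subst add_mult_distrib_mat_vec[of _ m m]) (auto intro!: eq_vecI)
      ultimately have Hw: "?H *\<^sub>v w - complex_of_real l \<cdot>\<^sub>v w = (-1) \<cdot>\<^sub>v v" by simp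
      have HwGG: "?H *\<^sub>v w = mat_adjoint G *\<^sub>v (G *\<^sub>v w)" by (rule assoc_mult_mat_vec[OF Ga G w])
      have Hwc: "?H *\<^sub>v w \<in> carrier_vec m" using H w by auto
      have vk: "v $ k = complex_of_real l * w $ k - (?H *\<^sub>v w) $ k" if "k < m" for k
        using arg_cong[OF Hw, of "\<lambda>x. x $ k"] that v w Hwc by (auto simp: algebra_simps minus_equation_iff)
      have form: "x \<bullet>c v = complex_of_real l * (x \<bullet>c w) - (G *\<^sub>v x) \<bullet>c (G *\<^sub>v w)"
        if x: "x \<in> carrier_vec m" for x
      proof -
        have "x \<bullet>c v = (\<Sum>k<m. x $ k * cnj (v $ k))"
          using v x by (auto simp: scalar_prod_def atLeast0LessThan)
        also have "\<dots> = complex_of_real l * (\<Sum>k<m. x $ k * cnj (w $ k)) - (\<Sum>k<m. x $ k * cnj ((?H *\<^sub>v w) $ k))"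
          unfolding sum_distrib_left sum_subtractf[symmetric]
          by (intro sum.cong) (auto simp: vk algebra_simps simp del: index_mult_mat_vec)
        also have "(\<Sum>k<m. x $ k * cnj (w $ k)) = x \<bullet>c w"
          using w x by (auto simp: scalar_prod_def atLeast0LessThan)
        also have "(\<Sum>k<m. x $ k * cnj ((?H *\<^sub>v w) $ k)) = x \<bullet>c (?H *\<^sub>v w)"
          using Hwc x Ga unfolding scalar_prod_def atLeast0LessThan by (auto simp del: index_mult_mat_vec)
        also have "\<dots> = (G *\<^sub>v x) \<bullet>c (G *\<^sub>v w)"
          unfolding HwGG using G x w by (intro cscalar_prod_mat_adjoint[symmetric]) auto
        finally show ?thesis .
      qed
      let ?q = "\<lambda>x. l * vec_sqnorm x - vec_sqnorm (G *\<^sub>v x)"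
      have "0 \<le> ?q (complex_of_real c \<cdot>\<^sub>v v - w)" using le[of "complex_of_real c \<cdot>\<^sub>v v - w"] v w by simp
      also have "G *\<^sub>v (complex_of_real c \<cdot>\<^sub>v v - w) = complex_of_real c \<cdot>\<^sub>v (G *\<^sub>v v) - G *\<^sub>v w"
        using G v w by (simp add: mult_minus_distrib_mat_vec[of _ r m] mult_mat_vec)
      also have "l * vec_sqnorm (complex_of_real c \<cdot>\<^sub>v v - w) - vec_sqnorm (complex_of_real c \<cdot>\<^sub>v (G *\<^sub>v v) - G *\<^sub>v w)
         = c\<^sup>2 * ?q v - 2 * c * Re (v \<bullet>c v) + ?q w"
        using G v w by (simp add: vec_sqnorm_scaled_diff[of _ m] vec_sqnorm_scaled_diff[of _ r] form[OF v] algebra_simps)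
      also have "?q w = Re (w \<bullet>c v)" using form[OF w] by (simp add: cscalar_prod_self)
      also have "Re (v \<bullet>c v) = vec_sqnorm v" by (simp add: cscalar_prod_self)
      finally have "2 * c * vec_sqnorm v \<le> c\<^sup>2 * ?q v + Re (w \<bullet>c v)" by simp
      also have "Re (w \<bullet>c v) \<le> sqrt (vec_sqnorm w) * sqrt (vec_sqnorm v)" by (rule Re_cscalar_prod_le[OF w v])
      also have "sqrt (vec_sqnorm w) \<le> c * sqrt (vec_sqnorm v)"
      proof -
        have "vec_sqnorm w = vec_sqnorm (N *\<^sub>v v)" using N v by (auto simp: w_def vec_sqnorm_def)
        also have "\<dots> \<le> mat_sqnorm N * vec_sqnorm v" by (rule vec_sqnorm_mult_mat_vec_le[OF N(1) v])
        finally have "sqrt (vec_sqnorm w) \<le> sqrt (mat_sqnorm N) * sqrt (vec_sqnorm v)"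
          by (metis real_sqrt_le_mono real_sqrt_mult)
        also have "\<dots> \<le> c * sqrt (vec_sqnorm v)"
          by (intro mult_right_mono) (auto simp: c_def vec_sqnorm_nonneg)
        finally show ?thesis .
      qed
      finally have "2 * c * vec_sqnorm v \<le> c\<^sup>2 * ?q v + c * vec_sqnorm v"
        using vec_sqnorm_nonneg[of v] by (simp add: mult.assoc mult_right_mono)
      then have "c * vec_sqnorm v \<le> c * (c * ?q v)" by (simp add: power2_eq_square algebra_simps)
      then show ?thesis using c by simp
    qed
    \<comment> \<open>On unit vectors the gap leaves |G v|^2 at most l - 1 / c, so the supremum
      \<open>l\<close> itself would be that small.\<close>
    have "l \<le> l - 1 / c"
      unfolding l_def
    proof (rule cSup_least[OF ne])
      fix x assume "x \<in> R"
      then obtain v where v: "v \<in> carrier_vec m" "vec_sqnorm v = 1" "x = vec_sqnorm (G *\<^sub>v v)"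
        by (auto simp: R_def)
      show "x \<le> Sup R - 1 / c" using gap[OF v(1)] v c by (simp add: l_def[symmetric] field_simps)
    qed
    then show False using c by simp
  qed
  with l0 le show ?thesis by (intro that)
qed

text \<open>\<open>Max\<close> is meaningful because the singular values form a finite set, squaring
  being injective on them with values in the finite spectrum, and a nonempty one, since it contains
  the root of the largest eigenvalue. The maximum is itself a singular value, hence attained at an
  eigenvector.\<close>

lemma sigma_max_props:
  assumes G: "G \<in> carrier_mat r m" and m: "m > 0"
  shows sigma_max_nonneg: "sigma_max G \<ge> 0"
    and sigma_max_bound: "v \<in> carrier_vec m \<Longrightarrow> vec_sqnorm (G *\<^sub>v v) \<le> (sigma_max G)\<^sup>2 * vec_sqnorm v"
    and sigma_max_attained: "\<exists>v\<in>carrier_vec m. vec_sqnorm v > 0 \<and> vec_sqnorm (G *\<^sub>v v) = (sigma_max G)\<^sup>2 * vec_sqnorm v"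
proof -
  let ?H = "mat_adjoint G * G"
  have H: "?H \<in> carrier_mat m m" using mat_adjoint_carrier[OF G] G by simp
  obtain l where l: "l \<ge> 0" "eigenvalue ?H (complex_of_real l)"
    "\<And>v. v \<in> carrier_vec m \<Longrightarrow> vec_sqnorm (G *\<^sub>v v) \<le> l * vec_sqnorm v"
    using gram_max_eigenvalue[OF G m] by blast
  have "finite ((\<lambda>s. complex_of_real (s\<^sup>2)) ` singular_values G)"
    by (rule finite_subset[OF _ card_finite_spectrum(1)[OF H]]) (auto simp: singular_values_def spectrum_def)
  moreover have "inj_on (\<lambda>s. complex_of_real (s\<^sup>2)) (singular_values G)"
    by (rule inj_onI) (auto simp: singular_values_def simp flip: of_real_power)
  ultimately have fin: "finite (singular_values G)" by (rule finite_imageD)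
  have mem: "sqrt l \<in> singular_values G" using l by (simp add: singular_values_def del: of_real_power)
  have "sigma_max G \<in> singular_values G" unfolding sigma_max_def using fin mem by (intro Max_in) auto
  then show "sigma_max G \<ge> 0" and ev: "\<exists>v\<in>carrier_vec m. vec_sqnorm v > 0 \<and> vec_sqnorm (G *\<^sub>v v) = (sigma_max G)\<^sup>2 * vec_sqnorm v"
    using gram_eigenvector_sqnorm[OF G] vec_sqnorm_nonneg vec_sqnorm_eq_0_iff
    by (auto simp: singular_values_def eigenvalue_def less_le simp del: of_real_power) metis
  have "sqrt l \<le> sigma_max G" unfolding sigma_max_def using fin mem by (rule Max_ge)
  then have "l \<le> (sigma_max G)\<^sup>2" using l(1) by (metis real_sqrt_ge_0_iff real_sqrt_pow2 power_mono)
  then show "vec_sqnorm (G *\<^sub>v v) \<le> (sigma_max G)\<^sup>2 * vec_sqnorm v" if "v \<in> carrier_vec m"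
    using l(3)[OF that] vec_sqnorm_nonneg[of v] by (meson mult_right_mono order_trans)
qed

text \<open>Lower semicontinuity: exceeding a nonnegative \<open>a\<close> means that some
  \<open>v\<close> is stretched by more than \<open>a\<close>, an open condition on \<omega> for
  each fixed \<open>v\<close>, and the union over all \<open>v\<close> is open without any
  countability.\<close>

lemma sigma_max_measurable:
  fixes G :: "real \<Rightarrow> complex mat"
  assumes G: "\<And>\<omega>. G \<omega> \<in> carrier_mat r m" and m: "m > 0"
    and cont: "\<And>j k. j < r \<Longrightarrow> k < m \<Longrightarrow> continuous_on UNIV (\<lambda>\<omega>. G \<omega> $$ (j, k))"
  shows "(\<lambda>\<omega>. sigma_max (G \<omega>)) \<in> borel_measurable borel"
proof (rule borel_measurableI_greater)
  fix a :: real
  note nn = sigma_max_nonneg[OF G m]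
  show "{\<omega>\<in>space borel. a < sigma_max (G \<omega>)} \<in> sets borel"
  proof (cases "a < 0")
    case True
    then have "{\<omega>\<in>space borel. a < sigma_max (G \<omega>)} = UNIV"
      using nn by (auto intro: less_le_trans)
    then show ?thesis by simp
  next
    case False
    have "{\<omega>\<in>space borel. a < sigma_max (G \<omega>)}
       = (\<Union>v\<in>carrier_vec m. {\<omega>. a\<^sup>2 * vec_sqnorm v < vec_sqnorm (G \<omega> *\<^sub>v v)})" (is "?L = ?R")
    proof (intro equalityI subsetI)
      fix \<omega> assume "\<omega> \<in> ?L"
      then have "a\<^sup>2 < (sigma_max (G \<omega>))\<^sup>2" using False by (intro power_strict_mono) auto
      with sigma_max_attained[OF G[of \<omega>] m] show "\<omega> \<in> ?R" by force
    next
      fix \<omega> assume "\<omega> \<in> ?R"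
      then obtain v where v: "v \<in> carrier_vec m" "a\<^sup>2 * vec_sqnorm v < vec_sqnorm (G \<omega> *\<^sub>v v)" by auto
      with sigma_max_bound[OF G[of \<omega>] m v(1)] have "a\<^sup>2 * vec_sqnorm v < (sigma_max (G \<omega>))\<^sup>2 * vec_sqnorm v" by simp
      then have "a\<^sup>2 < (sigma_max (G \<omega>))\<^sup>2" using vec_sqnorm_nonneg[of v] by (metis mult_right_mono not_le)
      then show "\<omega> \<in> ?L" using nn[of \<omega>] by (auto intro: power_less_imp_less_base)
    qed
    moreover have "open {\<omega>. a\<^sup>2 * vec_sqnorm v < vec_sqnorm (G \<omega> *\<^sub>v v)}" if v: "v \<in> carrier_vec m" for v
    proof -
      have eq: "(\<lambda>\<omega>. vec_sqnorm (G \<omega> *\<^sub>v v)) = (\<lambda>\<omega>. \<Sum>j<r. (cmod (\<Sum>k<m. G \<omega> $$ (j, k) * v $ k))\<^sup>2)"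
        using G v by (auto simp: vec_sqnorm_def scalar_prod_def atLeast0LessThan fun_eq_iff carrier_matD[OF G]
            intro!: sum.cong arg_cong[where f="\<lambda>x. (cmod x)\<^sup>2"])
      have "continuous_on UNIV (\<lambda>\<omega>. vec_sqnorm (G \<omega> *\<^sub>v v))"
        unfolding eq by (intro continuous_intros cont) auto
      then show ?thesis by (intro open_Collect_less continuous_intros)
    qed
    ultimately show ?thesis by (auto intro!: borel_open)
  qed
qed

text \<open>\<open>real_of_ereal\<close> sends infinite values to 0, so the essential supremum must
  be shown finite before \<open>hinf_norm G\<close> bounds anything. The Frobenius bound
  \<open>K\<close> caps it at sqrt K; it is at least 0 because the interval has positive
  measure.\<close>

lemma sigma_max_le_hinf_norm_AE:
  fixes G :: "complex \<Rightarrow> complex mat"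
  assumes G: "\<And>z. G z \<in> carrier_mat r m" and m: "m > 0"
    and cont: "\<And>j k. j < r \<Longrightarrow> k < m \<Longrightarrow> continuous_on UNIV (\<lambda>\<omega>. G (cis \<omega>) $$ (j, k))"
    and bound: "\<And>\<omega>. mat_sqnorm (G (cis \<omega>)) \<le> K"
  shows "AE \<omega> in restrict_space lborel {-pi..<pi}. sigma_max (G (cis \<omega>)) \<le> hinf_norm G"
    and "hinf_norm G \<ge> 0"
proof -
  let ?M = "restrict_space lborel {-pi..<pi}"
  let ?f = "\<lambda>\<omega>. ereal (sigma_max (G (cis \<omega>)))"
  note nn = sigma_max_nonneg[OF G m]
  have meas: "?f \<in> borel_measurable ?M"
    using sigma_max_measurable[of "\<lambda>\<omega>. G (cis \<omega>)", OF G m cont]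
    by (intro measurable_restrict_space1) auto
  have "sigma_max (G (cis \<omega>)) \<le> sqrt K" for \<omega>
  proof -
    obtain v where v: "v \<in> carrier_vec m" "vec_sqnorm v > 0"
      "vec_sqnorm (G (cis \<omega>) *\<^sub>v v) = (sigma_max (G (cis \<omega>)))\<^sup>2 * vec_sqnorm v"
      using sigma_max_attained[OF G m] by blast
    then have "(sigma_max (G (cis \<omega>)))\<^sup>2 * vec_sqnorm v \<le> mat_sqnorm (G (cis \<omega>)) * vec_sqnorm v"
      using vec_sqnorm_mult_mat_vec_le[OF G v(1)] by metis
    then have "(sigma_max (G (cis \<omega>)))\<^sup>2 \<le> K" using v(2) bound[of \<omega>] by simp
    then show ?thesis by (rule real_le_rsqrt)
  qed
  then have up: "esssup ?M ?f \<le> ereal (sqrt K)" using meas by (intro esssup_I) auto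
  have "emeasure ?M (space ?M) \<noteq> 0" by (simp add: emeasure_restrict_space space_restrict_space)
  from esssup_const[OF this, of "0::ereal"] have "0 = esssup ?M (\<lambda>_. 0::ereal)" by simp
  also have "\<dots> \<le> esssup ?M ?f" using nn by (intro esssup_mono) auto
  finally have low: "0 \<le> esssup ?M ?f" .
  have eq: "ereal (hinf_norm G) = esssup ?M ?f"
    unfolding hinf_norm_def using low up by (intro ereal_real') (auto simp: abs_eq_infinity_cases)
  show "AE \<omega> in ?M. sigma_max (G (cis \<omega>)) \<le> hinf_norm G"
    using esssup_AE[of ?f ?M] unfolding eq[symmetric] by simp
  show "hinf_norm G \<ge> 0" using low unfolding eq[symmetric] by simp
qed

subsection \<open>Parseval and convolution\<close>

abbreviation circle_measure :: "real measure" where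
  "circle_measure \<equiv> restrict_space lborel {-pi..<pi}"

lemma finite_measure_circle: "finite_measure circle_measure"
  by (rule finite_measureI) (simp add: emeasure_restrict_space space_restrict_space)

lemma integrable_circle:
  fixes f :: "real \<Rightarrow> 'b :: {banach, second_countable_topology}"
  assumes "f \<in> borel_measurable borel" "\<And>\<omega>. norm (f \<omega>) \<le> K"
  shows "integrable circle_measure f"
proof -
  interpret finite_measure circle_measure by (rule finite_measure_circle)
  show ?thesis
    using assms by (intro integrable_const_bound[where B=K] measurable_restrict_space1) auto
qed

text \<open>Orthogonality of the characters for Lebesgue measure without normalisation, whence the
  factors 2 pi. For nonzero \<open>k\<close> the primitive takes equal values at both ends of the
  period; closing the interval adds a null set.\<close>

lemma integral_cis_int:
  "(\<integral>\<omega>. cis (of_int k * \<omega>) \<partial>circle_measure) = (if k = 0 then complex_of_real (2 * pi) else 0)"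
proof -
  have "(LBINT \<omega>:{-pi..<pi}. cis (of_int k * \<omega>)) = (LBINT \<omega>:{-pi..pi}. cis (of_int k * \<omega>))"
    using AE_lborel_singleton[of pi]
    by (intro set_integral_cong_set) (auto simp: set_borel_measurable_def cis_conv_exp elim!: eventually_mono)
  then have eq: "(\<integral>\<omega>. cis (of_int k * \<omega>) \<partial>circle_measure) = (LBINT \<omega>:{-pi..pi}. cis (of_int k * \<omega>))"
    by (simp add: integral_restrict_space set_lebesgue_integral_def)
  show ?thesis
  proof (cases "k = 0")
    case True
    then show ?thesis unfolding eq
      by (simp add: set_lebesgue_integral_def scaleR_conv_of_real)
  next
    case False
    have "((\<lambda>z. exp (\<i> * of_int k * z) / (\<i> * of_int k)) has_field_derivative exp (\<i> * of_int k * complex_of_real \<omega>))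
        (at (complex_of_real \<omega>))" for \<omega>
      using False by (auto intro!: derivative_eq_intros)
    from has_vector_derivative_real_field[OF this]
    have d: "((\<lambda>\<omega>. cis (of_int k * \<omega>) / (\<i> * of_int k)) has_vector_derivative cis (of_int k * \<omega>)) (at \<omega> within {-pi..pi})" for \<omega>
      by (simp add: cis_conv_exp mult.assoc)
    have "(LBINT \<omega>=-pi..pi. cis (of_int k * \<omega>)) = cis (of_int k * pi) / (\<i> * of_int k) - cis (of_int k * (- pi)) / (\<i> * of_int k)"
      by (rule interval_integral_FTC_finite) (use d in \<open>auto intro!: continuous_intros\<close>)
    also have "cis (of_int k * pi) = cis (of_int k * (- pi))"
      using sin_npi_int[of k] by (simp add: complex_eq_iff mult.commute)
    finally show ?thesis using False unfolding eq
      by (simp add: interval_integral_Icc)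
  qed
qed

lemma cis_power_minus: "cis (- \<omega>) ^ s * cnj (cis (- \<omega>) ^ t) = cis (of_int (int t - int s) * \<omega>)"
  by (simp add: Complex.DeMoivre cis_cnj cis_mult algebra_simps)

lemma parseval_trig_polynomial:
  fixes a :: "nat \<Rightarrow> complex"
  shows "(\<integral>\<omega>. (cmod (\<Sum>t<N. a t * cis (- \<omega>) ^ t))\<^sup>2 \<partial>circle_measure) = 2 * pi * (\<Sum>t<N. (cmod (a t))\<^sup>2)"
proof -
  have int: "integrable circle_measure (\<lambda>\<omega>. b * cis (of_int k * \<omega>))" for b k
    by (rule integrable_circle[where K="cmod b"]) (auto simp: norm_mult cis_conv_exp)
  have "complex_of_real (\<integral>\<omega>. (cmod (\<Sum>t<N. a t * cis (- \<omega>) ^ t))\<^sup>2 \<partial>circle_measure)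
      = (\<integral>\<omega>. complex_of_real ((cmod (\<Sum>t<N. a t * cis (- \<omega>) ^ t))\<^sup>2) \<partial>circle_measure)"
    by (rule integral_complex_of_real[symmetric])
  also have "\<dots> = (\<integral>\<omega>. (\<Sum>s<N. \<Sum>t<N. a s * cnj (a t) * cis (of_int (int t - int s) * \<omega>)) \<partial>circle_measure)"
    unfolding complex_norm_square cis_power_minus[symmetric]
    by (simp add: sum_product mult_ac)
  also have "\<dots> = (\<Sum>s<N. \<Sum>t<N. \<integral>\<omega>. a s * cnj (a t) * cis (of_int (int t - int s) * \<omega>) \<partial>circle_measure)"
    by (subst Bochner_Integration.integral_sum, intro Bochner_Integration.integrable_sum int)
       (intro sum.cong refl Bochner_Integration.integral_sum int)
  also have "\<dots> = (\<Sum>s<N. \<Sum>t<N. if t = s then complex_of_real (2 * pi) * (a s * cnj (a t)) else 0)"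
    unfolding integral_mult_right_zero integral_cis_int by (intro sum.cong refl) auto
  also have "\<dots> = (\<Sum>s<N. complex_of_real (2 * pi) * (a s * cnj (a s)))"
    by (intro sum.cong refl) simp
  also have "\<dots> = complex_of_real (2 * pi * (\<Sum>t<N. (cmod (a t))\<^sup>2))"
    unfolding of_real_mult of_real_sum complex_norm_square sum_distrib_left by simp
  finally show ?thesis by (simp only: of_real_eq_iff)
qed

text \<open>The energies of the partial sums converge to that of the series by dominated
  convergence. They also increase, so each is at most the limit; this one-sided form is what a
  truncation to the first \<open>N\<close> coefficients calls for.\<close>

lemma bessel_fourier_series:
  fixes a :: "nat \<Rightarrow> complex"
  assumes a: "summable (\<lambda>t. cmod (a t))"
  shows "(\<lambda>\<omega>. \<Sum>t. a t * cis (- \<omega>) ^ t) \<in> borel_measurable borel"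
    and "cmod (\<Sum>t. a t * cis (- \<omega>) ^ t) \<le> (\<Sum>t. cmod (a t))"
    and "2 * pi * (\<Sum>t<N. (cmod (a t))\<^sup>2) \<le> (\<integral>\<omega>. (cmod (\<Sum>t. a t * cis (- \<omega>) ^ t))\<^sup>2 \<partial>circle_measure)"
proof -
  let ?p = "\<lambda>n \<omega>. \<Sum>t<n. a t * cis (- \<omega>) ^ t"
  let ?f = "\<lambda>\<omega>. \<Sum>t. a t * cis (- \<omega>) ^ t"
  have sn: "summable (\<lambda>t. norm (a t * cis (- \<omega>) ^ t))" for \<omega>
    using a by (simp add: norm_mult norm_power)
  have lim: "(\<lambda>n. ?p n \<omega>) \<longlonglongrightarrow> ?f \<omega>" for \<omega>
    by (rule summable_LIMSEQ[OF summable_norm_cancel[OF sn]])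
  have pm: "?p n \<in> borel_measurable borel" for n by (simp add: cis_conv_exp)
  show fm: "?f \<in> borel_measurable borel"
    by (rule borel_measurable_LIMSEQ_metric[OF pm lim])
  show fb: "cmod (?f \<omega>) \<le> (\<Sum>t. cmod (a t))" for \<omega>
    using summable_norm[OF sn[of \<omega>]] by (simp add: norm_mult norm_power)
  have pb: "cmod (?p n \<omega>) \<le> (\<Sum>t. cmod (a t))" for n \<omega>
  proof -
    have "cmod (?p n \<omega>) \<le> (\<Sum>t<n. cmod (a t))"
      by (rule sum_norm_le) (simp add: norm_mult norm_power)
    also have "\<dots> \<le> (\<Sum>t. cmod (a t))" using a by (intro sum_le_suminf) auto
    finally show ?thesis .
  qed
  have "(\<lambda>n. \<integral>\<omega>. (cmod (?p n \<omega>))\<^sup>2 \<partial>circle_measure) \<longlonglongrightarrow> (\<integral>\<omega>. (cmod (?f \<omega>))\<^sup>2 \<partial>circle_measure)"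
  proof (rule integral_dominated_convergence[where w="\<lambda>_. (\<Sum>t. cmod (a t))\<^sup>2"])
    show "integrable circle_measure (\<lambda>_. (\<Sum>t. cmod (a t))\<^sup>2)"
      by (rule integrable_circle[where K="(\<Sum>t. cmod (a t))\<^sup>2"]) auto
    show "AE \<omega> in circle_measure. (\<lambda>n. (cmod (?p n \<omega>))\<^sup>2) \<longlonglongrightarrow> (cmod (?f \<omega>))\<^sup>2"
      by (intro AE_I2 tendsto_intros lim)
    show "AE \<omega> in circle_measure. norm ((cmod (?p n \<omega>))\<^sup>2) \<le> (\<Sum>t. cmod (a t))\<^sup>2" for n
      using pb by (auto intro!: power_mono)
    show "(\<lambda>\<omega>. (cmod (?f \<omega>))\<^sup>2) \<in> borel_measurable circle_measure"
      using fm by (intro measurable_restrict_space1) simp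
    show "(\<lambda>\<omega>. (cmod (?p n \<omega>))\<^sup>2) \<in> borel_measurable circle_measure" for n
      using pm by (intro measurable_restrict_space1) simp
  qed
  then have "(\<lambda>n. 2 * pi * (\<Sum>t<n. (cmod (a t))\<^sup>2)) \<longlonglongrightarrow> (\<integral>\<omega>. (cmod (?f \<omega>))\<^sup>2 \<partial>circle_measure)"
    unfolding parseval_trig_polynomial .
  moreover have "incseq (\<lambda>n. 2 * pi * (\<Sum>t<n. (cmod (a t))\<^sup>2))"
    by (intro incseq_SucI) simp
  ultimately show "2 * pi * (\<Sum>t<N. (cmod (a t))\<^sup>2) \<le> (\<integral>\<omega>. (cmod (?f \<omega>))\<^sup>2 \<partial>circle_measure)"
    by (rule incseq_le[rotated])
qed

text \<open>The inverse of \<open>cis \<omega>\<close> is \<open>cis (- \<omega>)\<close>: this is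
  the transfer function with impulse response \<open>h\<close> at the point
  \<open>cis \<omega>\<close> of the unit circle.\<close>

definition frequency_response :: "nat \<Rightarrow> nat \<Rightarrow> (nat \<Rightarrow> nat \<Rightarrow> nat \<Rightarrow> real) \<Rightarrow> real \<Rightarrow> complex mat" where
  "frequency_response r m h \<omega> = mat r m (\<lambda>(j, k). \<Sum>t. complex_of_real (h t j k) * cis (- \<omega>) ^ t)"

text \<open>The cut-off input has a trigonometric polynomial \<open>U\<close> as transform, whose
  energy is exact by Parseval. The response may go on after time \<open>T\<close>; Bessel's
  inequality bounds the energy of its first \<open>T\<close> values by that of the full series
  \<open>Y\<close>. Pointwise, \<open>Y\<close> is the frequency response applied to
  \<open>U\<close>, by the Cauchy product of absolutely convergent series. As \<open>U\<close> is
  complex, the gain is assumed on complex vectors although the signals are real.\<close>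

lemma convolution_l2_gain:
  fixes h :: "nat \<Rightarrow> nat \<Rightarrow> nat \<Rightarrow> real" and u :: "nat \<Rightarrow> nat \<Rightarrow> real"
  assumes h: "\<And>j k. j < r \<Longrightarrow> k < m \<Longrightarrow> summable (\<lambda>t. \<bar>h t j k\<bar>)"
    and gain: "AE \<omega> in circle_measure. \<forall>v\<in>carrier_vec m.
       vec_sqnorm (frequency_response r m h \<omega> *\<^sub>v v) \<le> g\<^sup>2 * vec_sqnorm v"
  shows "(\<Sum>t<T. \<Sum>j<r. (\<Sum>s\<le>t. \<Sum>k<m. h (t - s) j k * u s k)\<^sup>2) \<le> g\<^sup>2 * (\<Sum>t<T. \<Sum>k<m. (u t k)\<^sup>2)"
proof -
  define v where "v t k = (if t < T then u t k else 0)" for t k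
  define y where "y t j = (\<Sum>k<m. \<Sum>s\<le>t. v s k * h (t - s) j k)" for t j
  have y: "(\<Sum>s\<le>t. \<Sum>k<m. h (t - s) j k * u s k) = y t j" if "t < T" for t j
    unfolding y_def using that
    by (subst sum.swap) (auto intro!: sum.cong simp: v_def mult.commute)
  define U where "U k \<omega> = (\<Sum>t<T. complex_of_real (u t k) * cis (- \<omega>) ^ t)" for k \<omega>
  define Y where "Y j \<omega> = (\<Sum>t. complex_of_real (y t j) * cis (- \<omega>) ^ t)" for j \<omega>
  have vsum: "summable (\<lambda>t. \<bar>v t k\<bar>)" for k
    by (rule summable_finite[of "{..<T}"]) (auto simp: v_def)
  have U: "(\<Sum>t. complex_of_real (v t k) * cis (- \<omega>) ^ t) = U k \<omega>" for k \<omega>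
    unfolding U_def by (subst suminf_finite[of "{..<T}"]) (auto simp: v_def)
  have ysum: "summable (\<lambda>t. cmod (complex_of_real (y t j)))" if j: "j < r" for j
  proof (rule summable_comparison_test')
    show "summable (\<lambda>t. \<Sum>k<m. \<Sum>s\<le>t. \<bar>v s k\<bar> * \<bar>h (t - s) j k\<bar>)"
      using vsum h[OF j] by (intro summable_sum summable_Cauchy_product) auto
    show "norm (cmod (complex_of_real (y t j))) \<le> (\<Sum>k<m. \<Sum>s\<le>t. \<bar>v s k\<bar> * \<bar>h (t - s) j k\<bar>)" if "t \<ge> 0" for t
      unfolding y_def norm_of_real real_norm_def abs_abs
      by (intro order_trans[OF sum_abs] sum_mono) (auto simp: abs_mult)
  qed
  have YGU: "Y j \<omega> = (\<Sum>k<m. frequency_response r m h \<omega> $$ (j, k) * U k \<omega>)" if j: "j < r" for j \<omega>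
  proof -
    have "(\<lambda>t. \<Sum>k<m. \<Sum>s\<le>t. (complex_of_real (v s k) * cis (- \<omega>) ^ s) * (complex_of_real (h (t - s) j k) * cis (- \<omega>) ^ (t - s)))
      sums (\<Sum>k<m. (\<Sum>t. complex_of_real (v t k) * cis (- \<omega>) ^ t) * (\<Sum>t. complex_of_real (h t j k) * cis (- \<omega>) ^ t))"
      using vsum h[OF j] by (intro sums_sum Cauchy_product_sums) (auto simp: norm_mult norm_power)
    also have "(\<lambda>t. \<Sum>k<m. \<Sum>s\<le>t. (complex_of_real (v s k) * cis (- \<omega>) ^ s) * (complex_of_real (h (t - s) j k) * cis (- \<omega>) ^ (t - s)))
      = (\<lambda>t. complex_of_real (y t j) * cis (- \<omega>) ^ t)"
    proof
      fix t
      have "(complex_of_real (v s k) * cis (- \<omega>) ^ s) * (complex_of_real (h (t - s) j k) * cis (- \<omega>) ^ (t - s))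
        = complex_of_real (v s k * h (t - s) j k) * cis (- \<omega>) ^ t" if "s \<le> t" for s k
      proof -
        have "cis (- \<omega>) ^ t = cis (- \<omega>) ^ s * cis (- \<omega>) ^ (t - s)"
          using that by (simp flip: power_add)
        then show ?thesis by simp
      qed
      then show "(\<Sum>k<m. \<Sum>s\<le>t. (complex_of_real (v s k) * cis (- \<omega>) ^ s) * (complex_of_real (h (t - s) j k) * cis (- \<omega>) ^ (t - s)))
        = complex_of_real (y t j) * cis (- \<omega>) ^ t"
        unfolding y_def of_real_sum sum_distrib_right by (intro sum.cong refl) auto
    qed
    finally show ?thesis unfolding Y_def U using j
      by (simp add: sums_iff frequency_response_def mult.commute)
  qed
  have Ym: "Y j \<in> borel_measurable borel" and Yb: "cmod (Y j \<omega>) \<le> (\<Sum>t. cmod (complex_of_real (y t j)))"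
    and Yi: "2 * pi * (\<Sum>t<T. (y t j)\<^sup>2) \<le> (\<integral>\<omega>. (cmod (Y j \<omega>))\<^sup>2 \<partial>circle_measure)" if "j < r" for j \<omega>
    using bessel_fourier_series(1)[OF ysum[OF that]] bessel_fourier_series(2)[OF ysum[OF that], of \<omega>]
      bessel_fourier_series(3)[OF ysum[OF that], of T]
    unfolding Y_def[abs_def] by auto
  have Yint: "integrable circle_measure (\<lambda>\<omega>. (cmod (Y j \<omega>))\<^sup>2)" if "j < r" for j
    using Ym[OF that] Yb[OF that]
    by (intro integrable_circle[where K="(\<Sum>t. cmod (complex_of_real (y t j)))\<^sup>2"]) (auto intro!: power_mono)
  have Uint: "integrable circle_measure (\<lambda>\<omega>. (cmod (U k \<omega>))\<^sup>2)" for k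
  proof (rule integrable_circle)
    show "(\<lambda>\<omega>. (cmod (U k \<omega>))\<^sup>2) \<in> borel_measurable borel" by (simp add: U_def cis_conv_exp)
    have "cmod (U k \<omega>) \<le> (\<Sum>t<T. \<bar>u t k\<bar>)" for \<omega>
      unfolding U_def by (rule sum_norm_le) (simp add: norm_mult norm_power)
    then show "norm ((cmod (U k \<omega>))\<^sup>2) \<le> (\<Sum>t<T. \<bar>u t k\<bar>)\<^sup>2" for \<omega> by (auto intro!: power_mono)
  qed
  have "2 * pi * (\<Sum>t<T. \<Sum>j<r. (y t j)\<^sup>2) = (\<Sum>j<r. 2 * pi * (\<Sum>t<T. (y t j)\<^sup>2))"
    by (subst sum.swap) (simp add: sum_distrib_left)
  also have "\<dots> \<le> (\<Sum>j<r. \<integral>\<omega>. (cmod (Y j \<omega>))\<^sup>2 \<partial>circle_measure)"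
    by (intro sum_mono Yi) auto
  also have "\<dots> = (\<integral>\<omega>. (\<Sum>j<r. (cmod (Y j \<omega>))\<^sup>2) \<partial>circle_measure)"
    using Yint by (intro Bochner_Integration.integral_sum[symmetric]) auto
  also have "\<dots> \<le> (\<integral>\<omega>. g\<^sup>2 * (\<Sum>k<m. (cmod (U k \<omega>))\<^sup>2) \<partial>circle_measure)"
  proof (rule integral_mono_AE)
    show "integrable circle_measure (\<lambda>\<omega>. \<Sum>j<r. (cmod (Y j \<omega>))\<^sup>2)" using Yint by auto
    show "integrable circle_measure (\<lambda>\<omega>. g\<^sup>2 * (\<Sum>k<m. (cmod (U k \<omega>))\<^sup>2))" using Uint by auto
    show "AE \<omega> in circle_measure. (\<Sum>j<r. (cmod (Y j \<omega>))\<^sup>2) \<le> g\<^sup>2 * (\<Sum>k<m. (cmod (U k \<omega>))\<^sup>2)"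
      using gain
    proof eventually_elim
      case (elim \<omega>)
      let ?G = "frequency_response r m h \<omega>"
      have "vec_sqnorm (?G *\<^sub>v vec m (\<lambda>k. U k \<omega>)) = (\<Sum>j<r. (cmod (Y j \<omega>))\<^sup>2)"
        unfolding vec_sqnorm_def
        by (intro sum.cong) (auto simp: YGU scalar_prod_def atLeast0LessThan frequency_response_def)
      moreover have "vec_sqnorm (vec m (\<lambda>k. U k \<omega>)) = (\<Sum>k<m. (cmod (U k \<omega>))\<^sup>2)"
        by (simp add: vec_sqnorm_def)
      ultimately show ?case using elim by (metis vec_carrier)
    qed
  qed
  also have "\<dots> = g\<^sup>2 * (\<Sum>k<m. \<integral>\<omega>. (cmod (U k \<omega>))\<^sup>2 \<partial>circle_measure)"
    using Uint by (simp add: Bochner_Integration.integral_sum)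
  also have "\<dots> = g\<^sup>2 * (\<Sum>k<m. 2 * pi * (\<Sum>t<T. (u t k)\<^sup>2))"
    unfolding U_def parseval_trig_polynomial by simp
  also have "\<dots> = 2 * pi * (g\<^sup>2 * (\<Sum>t<T. \<Sum>k<m. (u t k)\<^sup>2))"
    by (subst sum.swap) (simp add: sum_distrib_left mult_ac)
  finally have "(\<Sum>t<T. \<Sum>j<r. (y t j)\<^sup>2) \<le> g\<^sup>2 * (\<Sum>t<T. \<Sum>k<m. (u t k)\<^sup>2)" by simp
  then show ?thesis using y by simp
qed

subsection \<open>Stable linear systems and the Kalman filter\<close>

lemma smult_pow_mat:
  fixes A :: "'b :: comm_semiring_1 mat"
  assumes A: "A \<in> carrier_mat n n" shows "(a \<cdot>\<^sub>m A) ^\<^sub>m k = a ^ k \<cdot>\<^sub>m (A ^\<^sub>m k)"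
proof (induction k)
  case 0
  show ?case using A by (auto intro!: eq_matI)
next
  case (Suc k)
  then show ?case using A pow_carrier_mat[OF A, of k]
    by (auto intro!: eq_matI simp: scalar_prod_def sum_distrib_left mult_ac)
qed

text \<open>Division by a \<open>\<rho>\<close> strictly between the spectral radius and 1 leaves
  the spectral radius below 1, and the powers of such a matrix are uniformly bounded; scaling back
  gives geometric decay. In dimension 0 the spectrum is empty and has no largest modulus, hence the
  case split.\<close>

lemma schur_stable_power_bound:
  assumes M: "M \<in> carrier_mat n n" and "schur_stable M"
  shows "\<exists>c \<rho>. 0 \<le> \<rho> \<and> \<rho> < 1 \<and> (\<forall>k. \<forall>i<n. \<forall>j<n. \<bar>(M ^\<^sub>m k) $$ (i, j)\<bar> \<le> c * \<rho> ^ k)"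
proof (cases "n = 0")
  case True
  then show ?thesis by (intro exI[of _ 0]) auto
next
  case False
  then have n: "n > 0" by simp
  let ?M = "map_mat complex_of_real M"
  have Mc: "?M \<in> carrier_mat n n" using M by simp
  have sr: "spectral_radius ?M < 1" "spectral_radius ?M \<ge> 0"
    using spectral_radius_mem_max(1)[OF Mc n] assms(2) by (auto simp: schur_stable_def spectrum_def)
  define \<rho> where "\<rho> = (1 + spectral_radius ?M) / 2"
  have \<rho>: "0 < \<rho>" "\<rho> < 1" "spectral_radius ?M < \<rho>" using sr by (auto simp: \<rho>_def)
  let ?R = "complex_of_real (1 / \<rho>) \<cdot>\<^sub>m ?M"
  have Rc: "?R \<in> carrier_mat n n" using Mc by simp
  have "spectral_radius ?R < 1"
  proof -
    obtain z v where z: "spectral_radius ?R = cmod z" and v: "eigenvector ?R v z"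
      using spectral_radius_mem_max(1)[OF Rc n] by (auto simp: spectrum_def eigenvalue_def)
    have vc: "v \<in> carrier_vec n" and v0: "v \<noteq> 0\<^sub>v n" and eq: "?R *\<^sub>v v = z \<cdot>\<^sub>v v"
      using v M by (auto simp: eigenvector_def)
    have "?M *\<^sub>v v = (complex_of_real \<rho> * z) \<cdot>\<^sub>v v"
    proof (rule eq_vecI)
      fix i assume "i < dim_vec ((complex_of_real \<rho> * z) \<cdot>\<^sub>v v)"
      then have i: "i < n" using vc by auto
      have "z * v $ i = (?R *\<^sub>v v) $ i" using i vc eq by simp
      also have "\<dots> = complex_of_real (1 / \<rho>) * (?M *\<^sub>v v) $ i"
        using i vc M by (simp add: scalar_prod_def sum_distrib_left mult_ac)
      finally have "complex_of_real \<rho> * (z * v $ i) = (?M *\<^sub>v v) $ i"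
        using \<rho> by simp
      then show "(?M *\<^sub>v v) $ i = ((complex_of_real \<rho> * z) \<cdot>\<^sub>v v) $ i"
        using i vc by (simp add: mult.assoc del: index_mult_mat_vec)
    qed (use M vc in auto)
    then have "eigenvector ?M v (complex_of_real \<rho> * z)" using vc v0 M by (simp add: eigenvector_def)
    then have "cmod (complex_of_real \<rho> * z) \<le> spectral_radius ?M"
      by (intro spectral_radius_mem_max(2)[OF Mc n] imageI) (auto simp: spectrum_def eigenvalue_def)
    moreover have "cmod (complex_of_real \<rho> * z) = \<rho> * cmod z" using \<rho> by (simp add: norm_mult)
    ultimately have "\<rho> * cmod z < \<rho>" using \<rho> by linarith
    then show ?thesis using \<rho> z by simp
  qed
  from spectral_radius_jnf_norm_bound_less_1_upper_triangular[OF Rc this]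
  obtain c where c: "\<And>k. norm_bound (?R ^\<^sub>m k) c" by blast
  have "\<bar>(M ^\<^sub>m k) $$ (i, j)\<bar> \<le> c * \<rho> ^ k" if ij: "i < n" "j < n" for k i j
  proof -
    have "(?R ^\<^sub>m k) $$ (i, j) = complex_of_real ((1 / \<rho>) ^ k) * (?M ^\<^sub>m k) $$ (i, j)"
      unfolding smult_pow_mat[OF Mc] using ij M by simp
    also have "?M ^\<^sub>m k = map_mat complex_of_real (M ^\<^sub>m k)"
      by (rule of_real_hom.mat_hom_pow[OF M, symmetric])
    finally have "(?R ^\<^sub>m k) $$ (i, j) = complex_of_real ((1 / \<rho>) ^ k * (M ^\<^sub>m k) $$ (i, j))"
      using ij M by simp
    moreover have "cmod ((?R ^\<^sub>m k) $$ (i, j)) \<le> c"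
      using c[of k] ij unfolding norm_bound_def carrier_matD[OF pow_carrier_mat[OF Rc]] by blast
    ultimately have "\<bar>(1 / \<rho>) ^ k * (M ^\<^sub>m k) $$ (i, j)\<bar> \<le> c" by (simp only: norm_of_real)
    then show ?thesis using \<rho> by (simp add: abs_mult power_divide field_simps)
  qed
  then show ?thesis using \<rho> by (intro exI[of _ c] exI[of _ \<rho>]) auto
qed

section \<open>State-space realizations and their impulse responses\<close>

primrec lti_state :: "real mat \<Rightarrow> real mat \<Rightarrow> real vec \<Rightarrow> (nat \<Rightarrow> real vec) \<Rightarrow> nat \<Rightarrow> real vec" where
  "lti_state M N \<xi> u 0 = \<xi>"
| "lti_state M N \<xi> u (Suc t) = M *\<^sub>v lti_state M N \<xi> u t + N *\<^sub>v u t"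

text \<open>The Markov parameters, that is, the impulse response of z(t+1) = M z(t) + N u(t) with
  output E z(t) + F u(t): an input reaches the output at once through \<open>F\<close>, and through
  the state with a delay of one step.\<close>

fun markov :: "real mat \<Rightarrow> real mat \<Rightarrow> real mat \<Rightarrow> real mat \<Rightarrow> nat \<Rightarrow> real mat" where
  "markov M N E F 0 = F"
| "markov M N E F (Suc t) = E * (M ^\<^sub>m t) * N"

lemma lti_state_carrier:
  assumes "M \<in> carrier_mat n n" "N \<in> carrier_mat n m" "\<xi> \<in> carrier_vec n" "\<And>t. u t \<in> carrier_vec m"
  shows "lti_state M N \<xi> u t \<in> carrier_vec n"
  using assms by (induction t) auto

lemma mult_pow_mat_commute:
  assumes M: "M \<in> carrier_mat n n" shows "M * M ^\<^sub>m k = M ^\<^sub>m k * M"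
proof (induction k)
  case 0
  show ?case using M by simp
next
  case (Suc k)
  have "M * (M ^\<^sub>m k * M) = M * M ^\<^sub>m k * M"
    using M pow_carrier_mat[OF M, of k] by (simp add: assoc_mult_mat[of _ n n _ n _ n])
  with Suc show ?case by simp
qed

text \<open>\<open>E\<close> varies in the induction: reading the next state through
  \<open>E\<close> means reading the present one through \<open>E * M\<close> and adding
  \<open>E * N\<close> applied to the current input. The new factor \<open>M\<close> appears to the
  left of the powers, whence the commutation lemma.\<close>

lemma lti_state_output:
  assumes M: "M \<in> carrier_mat n n" and N: "N \<in> carrier_mat n m" and u: "\<And>t. u t \<in> carrier_vec m"
    and E: "E \<in> carrier_mat r n" and j: "j < r"
  shows "(E *\<^sub>v lti_state M N (0\<^sub>v n) u t) $ j = (\<Sum>s<t. ((E * M ^\<^sub>m (t - Suc s) * N) *\<^sub>v u s) $ j)"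
  using E
proof (induction t arbitrary: E)
  case 0
  then show ?case using j by simp
next
  case (Suc t)
  note E = Suc.prems
  let ?z = "lti_state M N (0\<^sub>v n) u"
  have z: "?z t \<in> carrier_vec n" by (rule lti_state_carrier[OF M N _ u]) auto
  have EM: "E * M \<in> carrier_mat r n" using E M by simp
  have p: "E * M * M ^\<^sub>m (t - Suc s) = E * M ^\<^sub>m (Suc t - Suc s)" if "s < t" for s
  proof -
    have "Suc t - Suc s = Suc (t - Suc s)" using that by simp
    then show ?thesis
      using E M pow_carrier_mat[OF M, of "t - Suc s"]
      by (simp add: assoc_mult_mat[of _ r n _ n _ n] mult_pow_mat_commute[OF M])
  qed
  have "E *\<^sub>v ?z (Suc t) = (E * M) *\<^sub>v ?z t + (E * N) *\<^sub>v u t"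
    using E M N z u by (simp add: mult_add_distrib_mat_vec[of _ r n] assoc_mult_mat_vec[of _ r n])
  then have "(E *\<^sub>v ?z (Suc t)) $ j = ((E * M) *\<^sub>v ?z t) $ j + ((E * N) *\<^sub>v u t) $ j"
    using E M N u[of t] j by simp
  also have "((E * M) *\<^sub>v ?z t) $ j = (\<Sum>s<t. ((E * M * M ^\<^sub>m (t - Suc s) * N) *\<^sub>v u s) $ j)"
    by (rule Suc.IH[OF EM])
  also have "\<dots> = (\<Sum>s<t. ((E * M ^\<^sub>m (Suc t - Suc s) * N) *\<^sub>v u s) $ j)"
    using p by (intro sum.cong) auto
  also have "E * N = E * M ^\<^sub>m (Suc t - Suc t) * N" using E M N by simp
  finally show ?case by simp
qed

lemma mult_mat_vec_index_sum:
  fixes G :: "'b :: semiring_0 mat"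
  assumes "G \<in> carrier_mat r m" "v \<in> carrier_vec m" "j < r"
  shows "(G *\<^sub>v v) $ j = (\<Sum>k<m. G $$ (j, k) * v $ k)"
  using assms by (auto simp: scalar_prod_def atLeast0LessThan intro!: sum.cong)

lemma markov_carrier:
  assumes "M \<in> carrier_mat n n" "N \<in> carrier_mat n m" "E \<in> carrier_mat r n" "F \<in> carrier_mat r m"
  shows "markov M N E F t \<in> carrier_mat r m"
  using assms pow_carrier_mat[OF assms(1)] by (cases t) (auto simp del: pow_mat.simps)

lemma lti_convolution:
  assumes M: "M \<in> carrier_mat n n" and N: "N \<in> carrier_mat n m" and u: "\<And>t. u t \<in> carrier_vec m"
    and E: "E \<in> carrier_mat r n" and F: "F \<in> carrier_mat r m" and j: "j < r"
  shows "(E *\<^sub>v lti_state M N (0\<^sub>v n) u t + F *\<^sub>v u t) $ j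
    = (\<Sum>s\<le>t. \<Sum>k<m. markov M N E F (t - s) $$ (j, k) * u s $ k)"
proof -
  have "(E *\<^sub>v lti_state M N (0\<^sub>v n) u t + F *\<^sub>v u t) $ j
    = (\<Sum>s<t. ((E * M ^\<^sub>m (t - Suc s) * N) *\<^sub>v u s) $ j) + (F *\<^sub>v u t) $ j"
    using F u[of t] j lti_state_output[OF M N u E j, where t=t] by simp
  also have "\<dots> = (\<Sum>s<t. (markov M N E F (t - s) *\<^sub>v u s) $ j) + (markov M N E F (t - t) *\<^sub>v u t) $ j"
  proof -
    have "markov M N E F (t - s) = E * M ^\<^sub>m (t - Suc s) * N" if "s < t" for s
    proof -
      have "t - s = Suc (t - Suc s)" using that by simp
      then show ?thesis by simp
    qed
    then show ?thesis by simp
  qed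
  also have "\<dots> = (\<Sum>s\<le>t. (markov M N E F (t - s) *\<^sub>v u s) $ j)"
    by (simp add: lessThan_Suc_atMost[symmetric])
  also have "\<dots> = (\<Sum>s\<le>t. \<Sum>k<m. markov M N E F (t - s) $$ (j, k) * u s $ k)"
    by (intro sum.cong refl mult_mat_vec_index_sum[OF markov_carrier[OF M N E F] u j])
  finally show ?thesis .
qed

lemma mult_mat_index_sum:
  fixes A B :: "'b :: semiring_0 mat"
  assumes "A \<in> carrier_mat r n" "B \<in> carrier_mat n m" "j < r" "k < m"
  shows "(A * B) $$ (j, k) = (\<Sum>b<n. A $$ (j, b) * B $$ (b, k))"
  using assms by (auto simp: scalar_prod_def atLeast0LessThan)

text \<open>The entries inherit the geometric decay of the powers of \<open>M\<close>; the
  feedthrough at time 0 is one extra term.\<close>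

lemma markov_summable:
  assumes M: "M \<in> carrier_mat n n" and N: "N \<in> carrier_mat n m"
    and E: "E \<in> carrier_mat r n" and F: "F \<in> carrier_mat r m" and "schur_stable M"
    and jk: "j < r" "k < m"
  shows "summable (\<lambda>t. \<bar>markov M N E F t $$ (j, k)\<bar>)"
proof -
  obtain c \<rho> where c: "0 \<le> \<rho>" "\<rho> < 1" "\<forall>t. \<forall>a<n. \<forall>b<n. \<bar>(M ^\<^sub>m t) $$ (a, b)\<bar> \<le> c * \<rho> ^ t"
    using schur_stable_power_bound[OF M assms(5)] by force
  have eq: "markov M N E F (Suc t) $$ (j, k) = (\<Sum>b<n. (\<Sum>a<n. E $$ (j, a) * (M ^\<^sub>m t) $$ (a, b)) * N $$ (b, k))" for t
    by (simp add: mult_mat_index_sum[OF mult_carrier_mat[OF E pow_carrier_mat[OF M]] N jk]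
        mult_mat_index_sum[OF E pow_carrier_mat[OF M] jk(1)] del: pow_mat.simps)
  have "summable (\<lambda>t. (\<Sum>b<n. (\<Sum>a<n. \<bar>E $$ (j, a)\<bar> * (c * \<rho> ^ t)) * \<bar>N $$ (b, k)\<bar>))"
    using c by (intro summable_sum summable_mult2 summable_mult summable_geometric) auto
  then have "summable (\<lambda>t. \<bar>markov M N E F (Suc t) $$ (j, k)\<bar>)"
  proof (rule summable_comparison_test')
    fix t :: nat
    show "norm \<bar>markov M N E F (Suc t) $$ (j, k)\<bar> \<le> (\<Sum>b<n. (\<Sum>a<n. \<bar>E $$ (j, a)\<bar> * (c * \<rho> ^ t)) * \<bar>N $$ (b, k)\<bar>)"
      unfolding eq real_norm_def abs_abs using c(3)
      by (intro order_trans[OF sum_abs] sum_mono)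
         (auto simp: abs_mult intro!: mult_right_mono order_trans[OF sum_abs] sum_mono mult_left_mono)
  qed
  then show ?thesis by (subst (asm) summable_Suc_iff)
qed

section \<open>The Kalman filter as a linear system in closed-loop form\<close>

text \<open>Both gains contain \<open>the\<close> of an optional inverse, whose dimensions are known
  only if the inverse exists; the invertibility of the innovation covariance that a stabilizing
  solution includes provides it.\<close>

lemma riccati_gain_carriers:
  assumes A: "A \<in> carrier_mat d d" and B: "B \<in> carrier_mat d p" and C: "C \<in> carrier_mat q d"
    and D: "D \<in> carrier_mat q p" and \<Sigma>: "stabilizing_riccati_solution A B C D \<Sigma>"
  shows "prediction_gain A B C D \<Sigma> \<in> carrier_mat d q" "filter_gain C D \<Sigma> \<in> carrier_mat d q"
proof -
  have S: "\<Sigma> \<in> carrier_mat d d" using \<Sigma> A by (simp add: stabilizing_riccati_solution_def)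
  have V: "innovation_cov C D \<Sigma> \<in> carrier_mat q q"
    using C D S by (simp add: innovation_cov_def)
  have "invertible_mat (innovation_cov C D \<Sigma>)"
    using \<Sigma> by (simp add: stabilizing_riccati_solution_def)
  then obtain W where W: "innovation_cov C D \<Sigma> * W = 1\<^sub>m q" "W * innovation_cov C D \<Sigma> = 1\<^sub>m (dim_row W)"
    using V by (auto simp: invertible_mat_def inverts_mat_def)
  \<comment> \<open>\<open>invertible_mat\<close> does not fix the shape of the inverse; it is read
    off from the column dimensions of the two products.\<close>
  from arg_cong[OF W(1), of dim_col] arg_cong[OF W(2), of dim_col] V
  have "W \<in> carrier_mat q q" by auto
  with W V have "innovation_cov C D \<Sigma> \<in> Units (ring_mat TYPE(real) q ())"
    by (auto simp: Units_def ring_mat_def)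
  then obtain Y where "mat_inverse (innovation_cov C D \<Sigma>) = Some Y"
    using mat_inverse(1)[OF V, where b="()"] by (cases "mat_inverse (innovation_cov C D \<Sigma>)") auto
  with mat_inverse(2)[OF V] have "the (mat_inverse (innovation_cov C D \<Sigma>)) \<in> carrier_mat q q" by auto
  then show "prediction_gain A B C D \<Sigma> \<in> carrier_mat d q" "filter_gain C D \<Sigma> \<in> carrier_mat d q"
    using A B C D S by (auto simp: prediction_gain_def filter_gain_def)
qed

text \<open>Stated for rectangular \<open>A\<close> to serve twice: for the state update with the
  prediction gain, and for the output with \<open>L\<close> in place of \<open>A\<close> and
  \<open>L * filter_gain C D \<Sigma>\<close> in place of \<open>K\<close>.\<close>

lemma feedback_mult_mat_vec:
  fixes A K C :: "real mat"
  assumes "A \<in> carrier_mat r d" "K \<in> carrier_mat r q" "C \<in> carrier_mat q d" "z \<in> carrier_vec d" "y \<in> carrier_vec q"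
  shows "A *\<^sub>v z + K *\<^sub>v (y - C *\<^sub>v z) = (A - K * C) *\<^sub>v z + K *\<^sub>v y"
proof -
  have "(A - K * C) *\<^sub>v z = A *\<^sub>v z - K *\<^sub>v (C *\<^sub>v z)"
    using assms by (simp add: minus_mult_distrib_mat_vec[of _ r d])
  moreover have "K *\<^sub>v (y - C *\<^sub>v z) = K *\<^sub>v y - K *\<^sub>v (C *\<^sub>v z)"
    using assms by (simp add: mult_minus_distrib_mat_vec[of _ r q])
  ultimately show ?thesis using assms
    by (auto intro!: eq_vecI)
qed

text \<open>Closing the loop on the innovation produces the very matrix whose Schur stability is
  demanded of a stabilizing solution.\<close>

lemma kalman_prediction_eq_lti_state:
  assumes A: "A \<in> carrier_mat d d" and C: "C \<in> carrier_mat q d" and K: "prediction_gain A B C D \<Sigma> \<in> carrier_mat d q"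
    and \<xi>: "\<xi> \<in> carrier_vec d" and y: "\<And>t. y t \<in> carrier_vec q"
  shows "kalman_prediction A B C D \<Sigma> \<xi> y t
    = lti_state (A - prediction_gain A B C D \<Sigma> * C) (prediction_gain A B C D \<Sigma>) \<xi> y t"
proof (induction t)
  case (Suc t)
  have "lti_state (A - prediction_gain A B C D \<Sigma> * C) (prediction_gain A B C D \<Sigma>) \<xi> y t \<in> carrier_vec d"
    using A C K \<xi> y by (intro lti_state_carrier[of _ d _ q]) auto
  from feedback_mult_mat_vec[OF A K C this y[of t]] show ?case by (simp add: Suc)
qed simp

text \<open>With H the filter gain, the correction by the current measurement changes the read-out
  matrix from L to L - L H C and creates the direct feedthrough L H.\<close>

lemma kalman_filter_output:
  assumes A: "A \<in> carrier_mat d d" and C: "C \<in> carrier_mat q d"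
    and K: "prediction_gain A B C D \<Sigma> \<in> carrier_mat d q" and H: "filter_gain C D \<Sigma> \<in> carrier_mat d q"
    and L: "L \<in> carrier_mat r d"
    and \<xi>: "\<xi> \<in> carrier_vec d" and y: "\<And>t. y t \<in> carrier_vec q"
  shows "L *\<^sub>v kalman_filter A B C D \<Sigma> \<xi> y t
    = (L - L * filter_gain C D \<Sigma> * C) *\<^sub>v
        lti_state (A - prediction_gain A B C D \<Sigma> * C) (prediction_gain A B C D \<Sigma>) \<xi> y t
      + (L * filter_gain C D \<Sigma>) *\<^sub>v y t"
proof -
  let ?z = "lti_state (A - prediction_gain A B C D \<Sigma> * C) (prediction_gain A B C D \<Sigma>) \<xi> y t"
  have z: "?z \<in> carrier_vec d"
    using A C K \<xi> y by (intro lti_state_carrier[of _ d _ q]) auto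
  have "L *\<^sub>v kalman_filter A B C D \<Sigma> \<xi> y t = L *\<^sub>v (?z + filter_gain C D \<Sigma> *\<^sub>v (y t - C *\<^sub>v ?z))"
    unfolding kalman_filter_def kalman_prediction_eq_lti_state[OF A C K \<xi> y] ..
  also have "\<dots> = L *\<^sub>v ?z + (L * filter_gain C D \<Sigma>) *\<^sub>v (y t - C *\<^sub>v ?z)"
    using L H z C y[of t] by (simp add: mult_add_distrib_mat_vec[of _ r d] assoc_mult_mat_vec[of _ r d])
  also have "\<dots> = (L - L * filter_gain C D \<Sigma> * C) *\<^sub>v ?z + (L * filter_gain C D \<Sigma>) *\<^sub>v y t"
    using L H by (intro feedback_mult_mat_vec[OF L _ C z y]) simp
  finally show ?thesis .
qed

lemma lti_state_diff:
  assumes "M \<in> carrier_mat n n" "N \<in> carrier_mat n m" "\<xi> \<in> carrier_vec n"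
    and u: "\<And>t. u t \<in> carrier_vec m" "\<And>t. u' t \<in> carrier_vec m"
  shows "lti_state M N \<xi> u t - lti_state M N \<xi> u' t = lti_state M N (0\<^sub>v n) (\<lambda>s. u s - u' s) t"
proof (induction t)
  case 0
  then show ?case using assms by simp
next
  case (Suc t)
  note z = lti_state_carrier[OF assms(1-3) u(1), where t=t] lti_state_carrier[OF assms(1-3) u(2), where t=t]
  have "M *\<^sub>v (lti_state M N \<xi> u t - lti_state M N \<xi> u' t) + N *\<^sub>v (u t - u' t)
    = (M *\<^sub>v lti_state M N \<xi> u t - M *\<^sub>v lti_state M N \<xi> u' t) + (N *\<^sub>v u t - N *\<^sub>v u' t)"
    using assms z by (simp add: mult_minus_distrib_mat_vec[of _ n n] mult_minus_distrib_mat_vec[of _ n m])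
  also have "\<dots> = lti_state M N \<xi> u (Suc t) - lti_state M N \<xi> u' (Suc t)"
    using assms z u by (auto intro!: eq_vecI)
  finally show ?case by (simp add: Suc)
qed

text \<open>The filter is affine in its measurements, and the common initial condition cancels in
  the difference.\<close>

lemma kalman_filter_output_diff:
  assumes A: "A \<in> carrier_mat d d" and C: "C \<in> carrier_mat q d"
    and K: "prediction_gain A B C D \<Sigma> \<in> carrier_mat d q" and H: "filter_gain C D \<Sigma> \<in> carrier_mat d q"
    and L: "L \<in> carrier_mat r d"
    and \<xi>: "\<xi> \<in> carrier_vec d" and y: "\<And>t. y t \<in> carrier_vec q" "\<And>t. y' t \<in> carrier_vec q"
  shows "L *\<^sub>v kalman_filter A B C D \<Sigma> \<xi> y t - L *\<^sub>v kalman_filter A B C D \<Sigma> \<xi> y' t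
    = L *\<^sub>v kalman_filter A B C D \<Sigma> (0\<^sub>v d) (\<lambda>s. y s - y' s) t"
proof -
  let ?M = "A - prediction_gain A B C D \<Sigma> * C"
  let ?N = "prediction_gain A B C D \<Sigma>"
  let ?E = "L - L * filter_gain C D \<Sigma> * C"
  let ?F = "L * filter_gain C D \<Sigma>"
  have M: "?M \<in> carrier_mat d d" and E: "?E \<in> carrier_mat r d" and F: "?F \<in> carrier_mat r q"
    using A C K L H by auto
  have yy: "y s - y' s \<in> carrier_vec q" for s using y by simp
  note z = lti_state_carrier[OF M K \<xi> y(1), where t=t] lti_state_carrier[OF M K \<xi> y(2), where t=t]
  have "?E *\<^sub>v (lti_state ?M ?N \<xi> y t - lti_state ?M ?N \<xi> y' t) + ?F *\<^sub>v (y t - y' t)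
    = (?E *\<^sub>v lti_state ?M ?N \<xi> y t - ?E *\<^sub>v lti_state ?M ?N \<xi> y' t) + (?F *\<^sub>v y t - ?F *\<^sub>v y' t)"
    by (simp only: mult_minus_distrib_mat_vec[OF E z] mult_minus_distrib_mat_vec[OF F y])
  also have "\<dots> = (?E *\<^sub>v lti_state ?M ?N \<xi> y t + ?F *\<^sub>v y t) - (?E *\<^sub>v lti_state ?M ?N \<xi> y' t + ?F *\<^sub>v y' t)"
  proof -
    have "(a - b) + (c - e) = (a + c) - (b + e)"
      if "a \<in> carrier_vec r" "b \<in> carrier_vec r" "c \<in> carrier_vec r" "e \<in> carrier_vec r" for a b c e :: "real vec"
      using that by (auto intro!: eq_vecI)
    then show ?thesis using E F z y by (meson mult_mat_vec_carrier)
  qed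
  finally show ?thesis
    unfolding kalman_filter_output[OF A C K H L \<xi> y(1)] kalman_filter_output[OF A C K H L \<xi> y(2)]
      kalman_filter_output[OF A C K H L zero_carrier_vec yy]
      lti_state_diff[OF M K \<xi> y] by simp
qed

lemma lti_state_input_mat:
  assumes "M \<in> carrier_mat n n" "K \<in> carrier_mat n q" "R \<in> carrier_mat q m" "\<And>t. u t \<in> carrier_vec m"
  shows "lti_state M K \<xi> (\<lambda>s. R *\<^sub>v u s) t = lti_state M (K * R) \<xi> u t"
  using assms by (induction t) (auto simp: assoc_mult_mat_vec[of _ n q _ m])

section \<open>From the H-infinity norm to an energy bound on finite windows\<close>

text \<open>Absolute summability gives uniform convergence by the Weierstrass test. Continuity will
  yield the measurability of the largest singular value, the bound a finite essential
  supremum.\<close>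

lemma frequency_response_entry:
  fixes a :: "nat \<Rightarrow> real"
  assumes a: "summable (\<lambda>t. \<bar>a t\<bar>)"
  shows "continuous_on UNIV (\<lambda>\<omega>. \<Sum>t. complex_of_real (a t) * cis (- \<omega>) ^ t)"
    and "cmod (\<Sum>t. complex_of_real (a t) * cis (- \<omega>) ^ t) \<le> (\<Sum>t. \<bar>a t\<bar>)"
proof -
  have "uniform_limit UNIV (\<lambda>n \<omega>. \<Sum>t<n. complex_of_real (a t) * cis (- \<omega>) ^ t)
      (\<lambda>\<omega>. \<Sum>t. complex_of_real (a t) * cis (- \<omega>) ^ t) sequentially"
    by (rule Weierstrass_m_test[OF _ a]) (simp add: norm_mult norm_power)
  then show "continuous_on UNIV (\<lambda>\<omega>. \<Sum>t. complex_of_real (a t) * cis (- \<omega>) ^ t)"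
    by (rule uniform_limit_theorem[rotated]) (auto intro!: continuous_intros always_eventually)
  show "cmod (\<Sum>t. complex_of_real (a t) * cis (- \<omega>) ^ t) \<le> (\<Sum>t. \<bar>a t\<bar>)"
    using bessel_fourier_series(2)[of "\<lambda>t. complex_of_real (a t)" \<omega>] a by simp
qed

text \<open>\<open>\<Phi>\<close> enters only through its impulse responses, the convolution only
  through \<open>h\<close>; that \<open>\<Phi>\<close> acts as this convolution is established where
  the lemma is applied.\<close>

lemma hinf_norm_l2_gain:
  fixes h :: "nat \<Rightarrow> nat \<Rightarrow> nat \<Rightarrow> real"
  assumes m: "m > 0"
    and h: "\<And>j k. j < r \<Longrightarrow> k < m \<Longrightarrow> summable (\<lambda>t. \<bar>h t j k\<bar>)"
    and resp: "\<And>j k t. j < r \<Longrightarrow> k < m \<Longrightarrow> \<Phi> (impulse m k) t $ j = h t j k"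
  shows "hinf_norm (transfer_function r m \<Phi>) \<ge> 0"
    and "(\<Sum>t<T. \<Sum>j<r. (\<Sum>s\<le>t. \<Sum>k<m. h (t - s) j k * u s k)\<^sup>2)
      \<le> (hinf_norm (transfer_function r m \<Phi>))\<^sup>2 * (\<Sum>t<T. \<Sum>k<m. (u t k)\<^sup>2)"
proof -
  let ?G = "transfer_function r m \<Phi>"
  have G: "?G z \<in> carrier_mat r m" for z by (simp add: transfer_function_def)
  have Gf: "?G (cis \<omega>) = frequency_response r m h \<omega>" for \<omega>
    unfolding transfer_function_def frequency_response_def
    by (rule eq_matI) (auto simp: resp cis_inverse)
  have entry: "?G (cis \<omega>) $$ (j, k) = (\<Sum>t. complex_of_real (h t j k) * cis (- \<omega>) ^ t)"
    if "j < r" "k < m" for \<omega> j k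
    using that by (simp add: Gf frequency_response_def)
  have cont: "continuous_on UNIV (\<lambda>\<omega>. ?G (cis \<omega>) $$ (j, k))" if "j < r" "k < m" for j k
    unfolding entry[OF that] by (rule frequency_response_entry(1)[OF h[OF that]])
  have bound: "mat_sqnorm (?G (cis \<omega>)) \<le> (\<Sum>j<r. \<Sum>k<m. (\<Sum>t. \<bar>h t j k\<bar>)\<^sup>2)" for \<omega>
    unfolding mat_sqnorm_def carrier_matD[OF G]
    by (intro sum_mono) (auto simp: entry intro!: power_mono frequency_response_entry(2) h)
  show nn: "hinf_norm ?G \<ge> 0" by (rule sigma_max_le_hinf_norm_AE(2)[OF G m cont bound])
  have "AE \<omega> in circle_measure. sigma_max (?G (cis \<omega>)) \<le> hinf_norm ?G"
    by (rule sigma_max_le_hinf_norm_AE(1)[OF G m cont bound])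
  \<comment> \<open>The exceptional frequencies do not depend on \<open>v\<close>: elsewhere the
    bound on the largest singular value covers all \<open>v\<close> together, so it may be used at
    the frequency-dependent transform of the input.\<close>
  then have "AE \<omega> in circle_measure. \<forall>v\<in>carrier_vec m.
       vec_sqnorm (frequency_response r m h \<omega> *\<^sub>v v) \<le> (hinf_norm ?G)\<^sup>2 * vec_sqnorm v"
  proof eventually_elim
    case (elim \<omega>)
    then have "(sigma_max (?G (cis \<omega>)))\<^sup>2 \<le> (hinf_norm ?G)\<^sup>2"
      using sigma_max_nonneg[OF G m] by (intro power_mono) auto
    then have "(sigma_max (?G (cis \<omega>)))\<^sup>2 * vec_sqnorm v \<le> (hinf_norm ?G)\<^sup>2 * vec_sqnorm v" for v
      by (rule mult_right_mono) (rule vec_sqnorm_nonneg)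
    then show ?case unfolding Gf[symmetric] using sigma_max_bound[OF G m] order_trans by blast
  qed
  then show "(\<Sum>t<T. \<Sum>j<r. (\<Sum>s\<le>t. \<Sum>k<m. h (t - s) j k * u s k)\<^sup>2)
      \<le> (hinf_norm ?G)\<^sup>2 * (\<Sum>t<T. \<Sum>k<m. (u t k)\<^sup>2)"
    by (intro convolution_l2_gain h)
qed

text \<open>The map is realized with the stable closed-loop matrix \<open>?M\<close>, and
  \<open>C * S\<close> is absorbed into the input matrix \<open>?N\<close> and the feedthrough
  \<open>?F\<close>; its impulse response consists of the absolutely summable Markov parameters. A
  positive dimension \<open>d\<close> ensures that singular values exist.\<close>

lemma sensitivity_map_l2_gain:
  assumes A: "A \<in> carrier_mat d d" and B: "B \<in> carrier_mat d p" and C: "C \<in> carrier_mat q d"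
    and D: "D \<in> carrier_mat q p" and L: "L \<in> carrier_mat r d" and S: "S \<in> carrier_mat d d"
    and \<Sigma>: "stabilizing_riccati_solution A B C D \<Sigma>" and d: "d > 0"
    and v: "\<And>t. v t \<in> carrier_vec d"
  defines "\<Phi> \<equiv> sensitivity_map A B C D L \<Sigma> S"
  shows "hinf_norm (transfer_function r d \<Phi>) \<ge> 0"
    and "(\<Sum>t<T. \<Sum>j<r. (\<Phi> v t $ j)\<^sup>2)
      \<le> (hinf_norm (transfer_function r d \<Phi>))\<^sup>2 * (\<Sum>t<T. \<Sum>k<d. (v t $ k)\<^sup>2)"
proof -
  let ?K = "prediction_gain A B C D \<Sigma>" and ?H = "filter_gain C D \<Sigma>"
  note K = riccati_gain_carriers(1)[OF A B C D \<Sigma>] and H = riccati_gain_carriers(2)[OF A B C D \<Sigma>]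
  let ?M = "A - ?K * C" and ?N = "?K * (C * S)" and ?E = "L - L * ?H * C" and ?F = "L * ?H * (C * S)"
  have M: "?M \<in> carrier_mat d d" and N: "?N \<in> carrier_mat d d" and E: "?E \<in> carrier_mat r d"
    and F: "?F \<in> carrier_mat r d" and CS: "C * S \<in> carrier_mat q d"
    using A C K L H S by auto
  have LH: "L * ?H \<in> carrier_mat r q" using L H by simp
  have stable: "schur_stable ?M" using \<Sigma> by (simp add: stabilizing_riccati_solution_def)
  let ?h = "\<lambda>t j k. markov ?M ?N ?E ?F t $$ (j, k)"
  have lti: "\<Phi> u t $ j = (\<Sum>s\<le>t. \<Sum>k<d. ?h (t - s) j k * u s $ k)"
    if u: "\<And>t. u t \<in> carrier_vec d" and j: "j < r" for u t j
  proof -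
    have CSu: "C *\<^sub>v (S *\<^sub>v u s) = (C * S) *\<^sub>v u s" for s
      by (rule assoc_mult_mat_vec[OF C S u, symmetric])
    have "\<Phi> u t = L *\<^sub>v kalman_filter A B C D \<Sigma> (0\<^sub>v d) (\<lambda>s. (C * S) *\<^sub>v u s) t"
      using A by (simp only: \<Phi>_def sensitivity_map_def CSu carrier_matD)
    also have "\<dots> = ?E *\<^sub>v lti_state ?M ?K (0\<^sub>v d) (\<lambda>s. (C * S) *\<^sub>v u s) t + (L * ?H) *\<^sub>v ((C * S) *\<^sub>v u t)"
      by (rule kalman_filter_output[OF A C K H L zero_carrier_vec mult_mat_vec_carrier[OF CS u]])
    also have "\<dots> = ?E *\<^sub>v lti_state ?M ?N (0\<^sub>v d) u t + ?F *\<^sub>v u t"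
      by (simp only: lti_state_input_mat[OF M K CS u] assoc_mult_mat_vec[OF LH CS u])
    finally show ?thesis using lti_convolution[OF M N u E F j, where t=t] by (simp only:)
  qed
  have resp: "\<Phi> (impulse d k) t $ j = ?h t j k" if jk: "j < r" "k < d" for j k t
  proof -
    have "\<Phi> (impulse d k) t $ j = (\<Sum>s\<le>t. \<Sum>k'<d. ?h (t - s) j k' * impulse d k s $ k')"
      by (rule lti) (auto simp: impulse_def jk)
    \<comment> \<open>An impulse is nonzero only at time 0 and in component \<open>k\<close>, so the
      convolution keeps the single term s = 0.\<close>
    also have "\<dots> = (\<Sum>s\<le>t. if s = 0 then ?h (t - s) j k else 0)"
    proof (rule sum.cong[OF refl])
      fix s
      have "(\<Sum>k'<d. ?h (t - s) j k' * impulse d k s $ k')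
        = (\<Sum>k'<d. if k' = k then (if s = 0 then ?h (t - s) j k else 0) else 0)"
        using jk by (intro sum.cong refl) (auto simp: impulse_def)
      then show "(\<Sum>k'<d. ?h (t - s) j k' * impulse d k s $ k') = (if s = 0 then ?h (t - s) j k else 0)"
        using jk by simp
    qed
    finally show ?thesis by simp
  qed
  note h = markov_summable[OF M N E F stable]
  show "hinf_norm (transfer_function r d \<Phi>) \<ge> 0"
    by (rule hinf_norm_l2_gain(1)[where h="?h" and \<Phi>=\<Phi> and r=r, OF d h resp])
  show "(\<Sum>t<T. \<Sum>j<r. (\<Phi> v t $ j)\<^sup>2)
      \<le> (hinf_norm (transfer_function r d \<Phi>))\<^sup>2 * (\<Sum>t<T. \<Sum>k<d. (v t $ k)\<^sup>2)"
    using hinf_norm_l2_gain(2)[where h="?h" and \<Phi>=\<Phi> and r=r, OF d h resp, where T=T and u="\<lambda>t k. v t $ k"] by (simp add: lti[OF v])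
qed

lemma selection_mat_mult_vec:
  assumes "x \<in> carrier_vec d"
  shows "selection_mat d J *\<^sub>v x = vec d (\<lambda>j. if j \<in> J then x $ j else 0)"
    and "(1\<^sub>m d - selection_mat d J) *\<^sub>v x = vec d (\<lambda>j. if j \<in> J then 0 else x $ j)"
proof -
  show eq: "selection_mat d J *\<^sub>v x = vec d (\<lambda>j. if j \<in> J then x $ j else 0)"
  proof (rule eq_vecI)
    fix j assume "j < dim_vec (vec d (\<lambda>j. if j \<in> J then x $ j else 0))"
    then have j: "j < d" by simp
    have "(selection_mat d J *\<^sub>v x) $ j = (\<Sum>k<d. selection_mat d J $$ (j, k) * x $ k)"
      by (rule mult_mat_vec_index_sum[of _ d]) (use assms j in \<open>auto simp: selection_mat_def\<close>)
    also have "\<dots> = (\<Sum>k<d. if k = j then (if j \<in> J then x $ j else 0) else 0)"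
      using j by (intro sum.cong) (auto simp: selection_mat_def)
    finally show "(selection_mat d J *\<^sub>v x) $ j = vec d (\<lambda>j. if j \<in> J then x $ j else 0) $ j"
      using j by simp
  qed (simp add: selection_mat_def)
  have "(1\<^sub>m d - selection_mat d J) *\<^sub>v x = x - selection_mat d J *\<^sub>v x"
    using assms by (subst minus_mult_distrib_mat_vec[of _ d d]) (auto simp: selection_mat_def)
  then show "(1\<^sub>m d - selection_mat d J) *\<^sub>v x = vec d (\<lambda>j. if j \<in> J then 0 else x $ j)"
    using assms unfolding eq by (auto intro!: eq_vecI)
qed

text \<open>As exp \<epsilon> is at least 1, coinciding events satisfy the privacy bound; this
  settles the case of equal noise-free outputs.\<close>

lemma measure_le_exp_mult_add_of_eq:
  assumes "prob_space P" "\<epsilon> > 0" "0 < \<delta>" "A = B"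
  shows "measure P A \<le> exp \<epsilon> * measure P B + \<delta>"
proof -
  have "1 * measure P B \<le> exp \<epsilon> * measure P B" using assms by (intro mult_right_mono) auto
  then show ?thesis using assms by simp
qed

theorem theorem5:
  fixes P :: "'a measure"
    and n r :: nat
    and d p q :: "nat \<Rightarrow> nat"
    and A B C D L \<Sigma> S :: "nat \<Rightarrow> real mat"
    and J :: "nat \<Rightarrow> nat set"
    and \<rho> \<gamma>i :: "nat \<Rightarrow> real"
    and \<epsilon> \<delta> \<gamma> :: real
    and xbar \<xi> :: "nat \<Rightarrow> real vec"
    and X w :: "nat \<Rightarrow> 'a \<Rightarrow> nat \<Rightarrow> real vec"
    and \<nu> :: "'a \<Rightarrow> nat \<Rightarrow> real vec"
  assumes "prob_space P"
    and "\<epsilon> > 0" and "0 < \<delta>" and "\<delta> < 1"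
    and "n \<ge> 1"
    and "\<And>i. i \<in> {1..n} \<Longrightarrow> \<rho> i \<ge> 0"
    and "\<And>i. i \<in> {1..n} \<Longrightarrow> A i \<in> carrier_mat (d i) (d i)"
    and "\<And>i. i \<in> {1..n} \<Longrightarrow> B i \<in> carrier_mat (d i) (p i)"
    and "\<And>i. i \<in> {1..n} \<Longrightarrow> C i \<in> carrier_mat (q i) (d i)"
    and "\<And>i. i \<in> {1..n} \<Longrightarrow> D i \<in> carrier_mat (q i) (p i)"
    and "\<And>i. i \<in> {1..n} \<Longrightarrow> L i \<in> carrier_mat r (d i)"
    and "\<And>i. i \<in> {1..n} \<Longrightarrow> J i \<subseteq> {..<d i}"
    and "\<And>i. i \<in> {1..n} \<Longrightarrow> S i = selection_mat (d i) (J i)"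
    and "\<And>i. i \<in> {1..n} \<Longrightarrow> full_row_rank (D i)"
    and "\<And>i. i \<in> {1..n} \<Longrightarrow> detectable (A i) (C i)"
    and "\<And>i. i \<in> {1..n} \<Longrightarrow> stabilizable (A i) (B i)"
    and "\<And>i. i \<in> {1..n} \<Longrightarrow> stabilizing_riccati_solution (A i) (B i) (C i) (D i) (\<Sigma> i)"
    and "\<And>i. i \<in> {1..n} \<Longrightarrow> \<xi> i \<in> carrier_vec (d i)"
    \<comment> \<open>the stochastic systems\<close>
    and "\<And>i. i \<in> {1..n} \<Longrightarrow> standard_white_noise P (p i) (w i)"
    and "\<And>i. i \<in> {1..n} \<Longrightarrow> gaussian_vector P (d i) (xbar i) (\<lambda>\<omega>. X i \<omega> 0)"
    and "\<And>i \<omega> t. i \<in> {1..n} \<Longrightarrow> \<omega> \<in> space P \<Longrightarrow>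
           X i \<omega> (Suc t) = A i *\<^sub>v X i \<omega> t + B i *\<^sub>v w i \<omega> t"
    and "\<And>i. i \<in> {1..n} \<Longrightarrow>
           indep_rv P (borel_vec (d i)) (\<lambda>\<omega>. X i \<omega> 0) (signal_space (p i)) (w i)"
    and "prob_space.indep_vars P (\<lambda>i. borel_vec (d i) \<Otimes>\<^sub>M signal_space (p i))
           (\<lambda>i \<omega>. (X i \<omega> 0, w i \<omega>)) {1..n}"
    \<comment> \<open>the privacy-preserving noise\<close>
    and "standard_white_noise P r \<nu>"
    and "indep_rv P (\<Pi>\<^sub>M i\<in>{1..n}. borel_vec (d i) \<Otimes>\<^sub>M signal_space (p i))
           (\<lambda>\<omega>. \<lambda>i\<in>{1..n}. (X i \<omega> 0, w i \<omega>)) (signal_space r) \<nu>"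
    and "\<And>i. i \<in> {1..n} \<Longrightarrow>
           \<gamma>i i = hinf_norm (transfer_function r (d i)
             (sensitivity_map (A i) (B i) (C i) (D i) (L i) (\<Sigma> i) (S i)))"
    and "\<gamma> = Max ((\<lambda>i. \<gamma>i i * \<rho> i) ` {1..n})"
  \<comment> \<open>\<open>\<omega>0\<close> fixes the realization of the measurement noises; the probability is that of \<open>\<nu>\<close>\<close>
  shows "\<forall>\<omega>0\<in>space P.
           differentially_private P (signal_space r) (adjacent n d S \<rho>)
             (\<lambda>x \<omega>. released_signal n r A B C D L \<Sigma> \<xi> (\<lambda>i t. D i *\<^sub>v w i \<omega>0 t)
                      (\<gamma> * kappa \<delta> \<epsilon>) (\<nu> \<omega>) x)
             \<epsilon> \<delta>"
proof (intro ballI, unfold differentially_private_def, intro allI impI ballI)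
  note eps = assms(2-4)
  note car = assms(7-11)
  fix \<omega>0 x x' Z
  assume "\<omega>0 \<in> space P" and adj: "adjacent n d S \<rho> x x'" and Z: "Z \<in> sets (signal_space r)"
  let ?v = "\<lambda>i t. D i *\<^sub>v w i \<omega>0 t" and ?c = "\<gamma> * kappa \<delta> \<epsilon>"
  define out where "out x i t = L i *\<^sub>v kalman_filter (A i) (B i) (C i) (D i) (\<Sigma> i) (\<xi> i)
    (\<lambda>s. C i *\<^sub>v x i s + D i *\<^sub>v w i \<omega>0 s) t" for x i t
  define m where "m x t = vec r (\<lambda>j. \<Sum>i=1..n. out x i t $ j)" for x t
  have released: "released_signal n r A B C D L \<Sigma> \<xi> ?v ?c (\<nu> \<omega>) x = (\<lambda>t. m x t + ?c \<cdot>\<^sub>v \<nu> \<omega> t)" for \<omega> x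
    by (rule ext) (simp add: released_signal_def m_def out_def)
  obtain i where i: "i \<in> {1..n}"
    and l2: "l2_signal (\<lambda>t. S i *\<^sub>v x i t - S i *\<^sub>v x' i t)"
      "l2_norm (\<lambda>t. S i *\<^sub>v x i t - S i *\<^sub>v x' i t) \<le> \<rho> i"
    and off: "\<And>t. (1\<^sub>m (d i) - S i) *\<^sub>v x i t = (1\<^sub>m (d i) - S i) *\<^sub>v x' i t"
    and same: "\<And>k t. k \<in> {1..n} \<Longrightarrow> k \<noteq> i \<Longrightarrow> x k t = x' k t"
    and x: "\<And>t. x i t \<in> carrier_vec (d i)" and x': "\<And>t. x' i t \<in> carrier_vec (d i)"
    using adj by (auto simp: adjacent_def trajectories_def)
  note A = car(1)[OF i] and B = car(2)[OF i] and C = car(3)[OF i] and D = car(4)[OF i] and L = car(5)[OF i]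
  note Si = assms(13)[OF i] and Ric = assms(17)[OF i] and \<xi> = assms(18)[OF i]
  define v where "v t = x i t - x' i t" for t
  have v: "v t \<in> carrier_vec (d i)" for t using x x' by (simp add: v_def)
  \<comment> \<open>The difference \<open>v\<close> lives on \<open>J i\<close> and is therefore
    fixed by \<open>S i\<close>. So \<open>S i\<close> may be inserted to the right of
    \<open>C i\<close>, which produces the map whose norm is \<open>\<gamma>i i\<close>, and the
    norm in the adjacency relation is that of \<open>v\<close> itself.\<close>
  have vJ: "v t $ j = 0" if "j < d i" "j \<notin> J i" for t j
  proof -
    have "vec (d i) (\<lambda>j. if j \<in> J i then 0 else x i t $ j) $ j = vec (d i) (\<lambda>j. if j \<in> J i then 0 else x' i t $ j) $ j"
      using off[of t] unfolding Si selection_mat_mult_vec(2)[OF x] selection_mat_mult_vec(2)[OF x'] by simp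
    then show ?thesis using that x[of t] x'[of t] by (simp add: v_def)
  qed
  have Sv: "S i *\<^sub>v v t = v t" for t
    unfolding Si selection_mat_mult_vec(1)[OF v] using v[of t] vJ by (auto intro!: eq_vecI)
  have Sdiff: "S i *\<^sub>v x i t - S i *\<^sub>v x' i t = v t" for t
    unfolding Si selection_mat_mult_vec(1)[OF x] selection_mat_mult_vec(1)[OF x']
    using x[of t] x'[of t] vJ[of _ t] by (auto intro!: eq_vecI simp: v_def)
  have energy: "(\<Sum>t<T. \<Sum>k<d i. (v t $ k)\<^sup>2) \<le> (\<rho> i)\<^sup>2" for T
  proof -
    have vv: "v t \<bullet> v t = (\<Sum>k<d i. (v t $ k)\<^sup>2)" for t
      using v[of t] by (simp add: scalar_prod_def atLeast0LessThan power2_eq_square)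
    have sm: "summable (\<lambda>t. \<Sum>k<d i. (v t $ k)\<^sup>2)" using l2(1) by (simp add: l2_signal_def Sdiff vv)
    then have "(\<Sum>t<T. \<Sum>k<d i. (v t $ k)\<^sup>2) \<le> (\<Sum>t. \<Sum>k<d i. (v t $ k)\<^sup>2)"
      by (intro sum_le_suminf) (auto intro!: sum_nonneg)
    also have "\<dots> \<le> (\<rho> i)\<^sup>2"
    proof (rule sqrt_le_D)
      show "sqrt (\<Sum>t. \<Sum>k<d i. (v t $ k)\<^sup>2) \<le> \<rho> i" using l2(2) by (simp add: l2_norm_def Sdiff vv)
    qed
    finally show ?thesis .
  qed
  let ?\<Phi> = "sensitivity_map (A i) (B i) (C i) (D i) (L i) (\<Sigma> i) (S i)"
  \<comment> \<open>Systems other than \<open>i\<close> contribute equal terms; the measurement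
    noise cancels in the filter input and \<open>\<xi> i\<close> in the filter state.\<close>
  have diff: "m x t $ j - m x' t $ j = ?\<Phi> v t $ j" if j: "j < r" for t j
  proof -
    have y: "C i *\<^sub>v x i s + D i *\<^sub>v w i \<omega>0 s \<in> carrier_vec (q i)"
      "C i *\<^sub>v x' i s + D i *\<^sub>v w i \<omega>0 s \<in> carrier_vec (q i)" for s
      using C D by (auto intro!: carrier_vecI)
    have yy: "(C i *\<^sub>v x i s + D i *\<^sub>v w i \<omega>0 s) - (C i *\<^sub>v x' i s + D i *\<^sub>v w i \<omega>0 s) = C i *\<^sub>v (S i *\<^sub>v v s)" for s
    proof -
      have "C i *\<^sub>v v s = C i *\<^sub>v x i s - C i *\<^sub>v x' i s"
        unfolding v_def by (rule mult_minus_distrib_mat_vec[OF C x x'])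
      then show ?thesis unfolding Sv using C D by (auto intro!: eq_vecI)
    qed
    have "m x t $ j - m x' t $ j = (\<Sum>k=1..n. out x k t $ j - out x' k t $ j)"
      using j by (simp add: m_def sum_subtractf)
    also have "\<dots> = (\<Sum>k=1..n. if k = i then out x k t $ j - out x' k t $ j else 0)"
      using same by (intro sum.cong) (auto simp: out_def)
    also have "\<dots> = out x i t $ j - out x' i t $ j" using i by simp
    also have "\<dots> = (out x i t - out x' i t) $ j" using L j by (simp add: out_def)
    also have "out x i t - out x' i t = ?\<Phi> v t"
      unfolding out_def sensitivity_map_def carrier_matD(1)[OF A] yy[symmetric]
      by (rule kalman_filter_output_diff[OF A C riccati_gain_carriers[OF A B C D Ric] L \<xi> y])
    finally show ?thesis .
  qed
  have mc: "m x t \<in> carrier_vec r" for x t by (simp add: m_def)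
  show "measure P {\<omega> \<in> space P. released_signal n r A B C D L \<Sigma> \<xi> ?v ?c (\<nu> \<omega>) x \<in> Z}
    \<le> exp \<epsilon> * measure P {\<omega> \<in> space P. released_signal n r A B C D L \<Sigma> \<xi> ?v ?c (\<nu> \<omega>) x' \<in> Z} + \<delta>"
  \<comment> \<open>Equal outputs are settled whatever the noise level, zero included. If they
    differ at some time and component, the noise level turns out positive and the Gaussian mechanism
    applies.\<close>
  proof (cases "\<forall>t. m x t = m x' t")
    case True
    then have "m x = m x'" by auto
    then show ?thesis unfolding released by (intro measure_le_exp_mult_add_of_eq[OF assms(1) eps(1,2)]) simp
  next
    case False
    then obtain t0 where "m x t0 \<noteq> m x' t0" by blast
    then obtain j0 where j0: "j0 < r" "m x t0 $ j0 \<noteq> m x' t0 $ j0"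
      using mc by (metis carrier_vecD eq_vecI)
    \<comment> \<open>For \<open>d i = 0\<close> there are no singular values and \<open>\<gamma>i i\<close> is the unspecified \<open>Max {}\<close>.\<close>
    have "d i > 0"
    proof (rule ccontr)
      assume "\<not> d i > 0"
      then have "x i t = x' i t" for t using x[of t] x'[of t] by (auto intro!: eq_vecI)
      with same have "out x k t = out x' k t" if "k \<in> {1..n}" for k t
        using that by (cases "k = i") (simp_all add: out_def)
      then show False using j0 by (simp add: m_def)
    qed
    note gain = sensitivity_map_l2_gain[OF A B C D L _ Ric this v, of "S i"]
    have Sc: "S i \<in> carrier_mat (d i) (d i)" by (simp add: Si selection_mat_def)
    have \<gamma>i: "\<gamma>i i \<ge> 0" unfolding assms(26)[OF i] by (rule gain(1)[OF Sc])
    have sens: "(\<Sum>t<T. \<Sum>j<r. (m x t $ j - m x' t $ j)\<^sup>2) \<le> (\<gamma>i i * \<rho> i)\<^sup>2" for T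
    proof -
      have "(\<Sum>t<T. \<Sum>j<r. (m x t $ j - m x' t $ j)\<^sup>2) = (\<Sum>t<T. \<Sum>j<r. (?\<Phi> v t $ j)\<^sup>2)"
        by (simp add: diff)
      also have "\<dots> \<le> (\<gamma>i i)\<^sup>2 * (\<Sum>t<T. \<Sum>k<d i. (v t $ k)\<^sup>2)"
        unfolding assms(26)[OF i] by (rule gain(2)[OF Sc])
      also have "\<dots> \<le> (\<gamma>i i)\<^sup>2 * (\<rho> i)\<^sup>2" by (intro mult_left_mono energy) simp
      finally show ?thesis by (simp add: power_mult_distrib)
    qed
    have \<Delta>: "\<gamma>i i * \<rho> i \<ge> 0" using \<gamma>i assms(6)[OF i] by simp
    \<comment> \<open>The maximum dominates its \<open>i\<close>-th term whatever the other terms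
      are, including unspecified values at systems of dimension 0.\<close>
    have \<Delta>\<gamma>: "\<gamma>i i * \<rho> i \<le> \<gamma>" unfolding assms(27) using i by (intro Max_ge) auto
    \<comment> \<open>A zero bound on the window of length \<open>Suc t0\<close>, which includes
      time \<open>t0\<close>, would make the outputs agree at \<open>t0\<close>.\<close>
    have "\<gamma>i i * \<rho> i \<noteq> 0"
    proof
      assume zero: "\<gamma>i i * \<rho> i = 0"
      have le0: "(\<Sum>t<Suc t0. \<Sum>j<r. (m x t $ j - m x' t $ j)\<^sup>2) \<le> 0" using sens[of "Suc t0"] unfolding zero by simp
      have "(m x t0 $ j0 - m x' t0 $ j0)\<^sup>2 \<le> (\<Sum>j<r. (m x t0 $ j - m x' t0 $ j)\<^sup>2)"
        using j0 by (intro member_le_sum) auto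
      also have "\<dots> \<le> (\<Sum>t<Suc t0. \<Sum>j<r. (m x t $ j - m x' t $ j)\<^sup>2)"
        by (intro member_le_sum[of t0 "{..<Suc t0}" "\<lambda>t. \<Sum>j<r. (m x t $ j - m x' t $ j)\<^sup>2"]) (auto intro!: sum_nonneg)
      finally have "(m x t0 $ j0 - m x' t0 $ j0)\<^sup>2 \<le> 0" using le0 by linarith
      then show False using j0 by simp
    qed
    then have "\<gamma> > 0" using \<Delta> \<Delta>\<gamma> by linarith
    note kp = kappa_pos[OF eps(1), of \<delta>]
    show ?thesis
      unfolding released
    proof (rule gaussian_mechanism_signal_space[OF assms(1,24) eps _ _ mc mc sens \<Delta> Z])
      show "?c > 0" using kp \<open>\<gamma> > 0\<close> by simp
      show "\<gamma>i i * \<rho> i * kappa \<delta> \<epsilon> \<le> ?c" using kp \<Delta>\<gamma> by (intro mult_right_mono) auto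
    qed
  qed
qed

end
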